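(* Let $D$ be a fundamental discriminant. The vanishing locus $W_D$ of $\mathcal{D}\theta_D$ is disjoint in $X_D$ from the reducible locus $P_D$.
   Context: $K=\mathbb{Q}(\sqrt D)\subset\mathbb{R}$ with conjugation $\sigma$; $\mathcal{O}_D$ the ring of integers, $\mathcal{O}_D^\vee$ its trace dual; $X_D=\mathbb{H}^2/\mathrm{SL}(\mathcal{O}_D^\vee\oplus\mathcal{O}_D)$ with $\mathrm{SL}(\mathcal{O}_D^\vee\oplus\mathcal{O}_D)=\{\begin{pmatrix}a&b\\c&d\end{pmatrix}\in\mathrm{SL}_2(K):a,d\in\mathcal{O}_D,b\in\mathcal{O}_D^\vee,c\in(\mathcal{O}_D^\vee)^{-1}\}$ acting by $(z_1,z_2)\mapsto(\gamma z_1,\gamma^\sigma z_2)$. Characteristics $(m,m')$ with $m,m'\in\{0,\frac12\}^2$ are odd if $4m\cdot m'$ is odd. With $\gamma_0=\frac{D+\sqrt D}2$, $\rho_m(x)=(x_1+m_1)+(x_2+m_2)\gamma_0$, $e(x)=e^{2\pi ix}$: $D_2\theta[m;m'](z_1,z_2)=i^{4m\cdot m'}\sum_{x\in\mathbb{Z}^2}(-1)^{2x\cdot m'}\rho_m(x)^\sigma e(\frac12\rho_m(x)^2z_1+\frac12(\rho_m(x)^\sigma)^2z_2)$ and $\mathcal{D}\theta_D=\prod_{(m,m')\text{ odd}}D_2\theta[m;m']$; its vanishing locus in $X_D$ is denoted $W_D$. Each $\mathbf z\in\mathbb{H}^2$ gives the principally polarized abelian surface $\mathbb{C}^2/\{(az_1+b,a^\sigma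 z_2+b^\sigma):a\in\mathcal{O}_D^\vee,b\in\mathcal{O}_D\}$ (polarization from $\mathrm{tr}(ab'-a'b)$); $P_D\subset X_D$ is the locus where this surface is isomorphic, as a polarized abelian variety, to a product of two elliptic curves.
   Formalization: The abelian surface attached to z is taken with a in O_D and b in the trace dual (roles swapped), since with a in the dual and b in O_D its isomorphism class is not invariant under the stated group, so P_D would not be a locus in X_D; D is positive and not 1. *)

theory Defs
  imports
    "HOL-Analysis.Analysis"
    "HOL-Computational_Algebra.Polynomial"
    "HOL-Computational_Algebra.Squarefree"
begin

section \<open>The real quadratic field\<close>

text \<open>Discriminants of quadratic number fields; thus \<open>D = 1\<close> is excluded.\<close>

definition fundamental_discriminant :: "int \<Rightarrow> bool" where
  "fundamental_discriminant D \<longleftrightarrow>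
     D \<noteq> 1 \<and>
     ((D mod 4 = 1 \<and> squarefree D) \<or>
      (4 dvd D \<and> (D div 4) mod 4 \<in> {2, 3} \<and> squarefree (D div 4)))"

definition quad_field :: "int \<Rightarrow> real set" where
  "quad_field D = {x + y * sqrt (of_int D) |x y. x \<in> \<rat> \<and> y \<in> \<rat>}"

text \<open>The Galois conjugation. It is only meaningful on \<open>quad_field D\<close>, and for \<open>D\<close> not a
  square.\<close>

definition quad_conj :: "int \<Rightarrow> real \<Rightarrow> real" where
  "quad_conj D z = (THE w. \<exists>x\<in>\<rat>. \<exists>y\<in>\<rat>.
     z = x + y * sqrt (of_int D) \<and> w = x - y * sqrt (of_int D))"

definition quad_trace :: "int \<Rightarrow> real \<Rightarrow> real" where
  "quad_trace D x = x + quad_conj D x"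

definition ring_of_ints :: "int \<Rightarrow> real set" where
  "ring_of_ints D = {x \<in> quad_field D. algebraic_int x}"

definition trace_dual :: "int \<Rightarrow> real set" where
  "trace_dual D = {x \<in> quad_field D. \<forall>y\<in>ring_of_ints D. quad_trace D (x * y) \<in> \<int>}"

text \<open>The inverse of \<open>trace_dual D\<close> as a fractional ideal.\<close>

definition inv_trace_dual :: "int \<Rightarrow> real set" where
  "inv_trace_dual D = {x \<in> quad_field D. \<forall>y\<in>trace_dual D. x * y \<in> ring_of_ints D}"


section \<open>The Hilbert modular surface\<close>

definition HH :: "(complex \<times> complex) set" where
  "HH = {z. Im (fst z) > 0 \<and> Im (snd z) > 0}"

definition SL_dual :: "int \<Rightarrow> (real^2^2) set" where
  "SL_dual D = {g. det g = 1 \<and>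
     g $ 1 $ 1 \<in> ring_of_ints D \<and> g $ 1 $ 2 \<in> trace_dual D \<and>
     g $ 2 $ 1 \<in> inv_trace_dual D \<and> g $ 2 $ 2 \<in> ring_of_ints D}"

definition moebius :: "real^2^2 \<Rightarrow> complex \<Rightarrow> complex" where
  "moebius g z = (of_real (g $ 1 $ 1) * z + of_real (g $ 1 $ 2)) /
                 (of_real (g $ 2 $ 1) * z + of_real (g $ 2 $ 2))"

definition act :: "int \<Rightarrow> real^2^2 \<Rightarrow> complex \<times> complex \<Rightarrow> complex \<times> complex" where
  "act D g z = (moebius g (fst z), moebius (map_matrix (quad_conj D) g) (snd z))"

definition orbit_rel :: "int \<Rightarrow> ((complex \<times> complex) \<times> (complex \<times> complex)) set" where
  "orbit_rel D = {(z, w). z \<in> HH \<and> w \<in> HH \<and> (\<exists>g\<in>SL_dual D. w = act D g z)}"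

definition X_surface :: "int \<Rightarrow> (complex \<times> complex) set set" where
  "X_surface D = HH // orbit_rel D"


section \<open>Theta derivatives\<close>

type_synonym half_vec = "real \<times> real"

definition characteristics :: "(half_vec \<times> half_vec) set" where
  "characteristics = ({0, 1/2} \<times> {0, 1/2}) \<times> ({0, 1/2} \<times> {0, 1/2})"

definition odd_characteristics :: "(half_vec \<times> half_vec) set" where
  "odd_characteristics =
     {(m, m') \<in> characteristics. \<exists>k::int. odd k \<and> 4 * (m \<bullet> m') = of_int k}"

definition gamma0 :: "int \<Rightarrow> real" where
  "gamma0 D = (of_int D + sqrt (of_int D)) / 2"

definition rho :: "int \<Rightarrow> half_vec \<Rightarrow> int \<times> int \<Rightarrow> real" where
  "rho D m x = (of_int (fst x) + fst m) + (of_int (snd x) + snd m) * gamma0 D"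

definition e2pi :: "complex \<Rightarrow> complex" where
  "e2pi z = exp (2 * of_real pi * \<i> * z)"

text \<open>The arguments of \<open>floor\<close> below are integers whenever \<open>(m, m')\<close> is a characteristic; the
  floor only turns them into exponents of type \<^typ>\<open>int\<close>. The series converges absolutely
  on \<open>HH\<close>.\<close>

definition D2_theta :: "int \<Rightarrow> half_vec \<Rightarrow> half_vec \<Rightarrow> complex \<times> complex \<Rightarrow> complex" where
  "D2_theta D m m' z =
     \<i> powi \<lfloor>4 * (m \<bullet> m')\<rfloor> *
     (\<Sum>\<^sub>\<infinity>x\<in>UNIV.
        (-1) powi \<lfloor>2 * ((of_int (fst x), of_int (snd x)) \<bullet> m')\<rfloor> *
        of_real (quad_conj D (rho D m x)) *
        e2pi (1/2 * of_real ((rho D m x)\<^sup>2) * fst z +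
              1/2 * of_real ((quad_conj D (rho D m x))\<^sup>2) * snd z))"

definition D_theta :: "int \<Rightarrow> complex \<times> complex \<Rightarrow> complex" where
  "D_theta D z = (\<Prod>(m, m')\<in>odd_characteristics. D2_theta D m m' z)"

definition W_locus :: "int \<Rightarrow> (complex \<times> complex) set set" where
  "W_locus D = {c \<in> X_surface D. \<exists>z\<in>c. D_theta D z = 0}"


section \<open>Principally polarized abelian varieties\<close>

text \<open>A pair \<open>(\<Lambda>, E)\<close> stands for the complex torus \<open>\<complex>\<^sup>n / \<Lambda>\<close> with the polarization given by
  the alternating form \<open>E\<close> on \<open>\<Lambda>\<close>; the values of \<open>E\<close> off \<open>\<Lambda>\<close> are irrelevant.\<close>

type_synonym 'n torus = "(complex^'n) set \<times> (complex^'n \<Rightarrow> complex^'n \<Rightarrow> real)"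

definition is_lattice :: "'a::real_vector set \<Rightarrow> bool" where
  "is_lattice \<Lambda> \<longleftrightarrow> (\<exists>B. finite B \<and> independent B \<and> span B = UNIV \<and>
     \<Lambda> = range (\<lambda>c::'a \<Rightarrow> int. \<Sum>b\<in>B. of_int (c b) *\<^sub>R b))"

text \<open>\<open>F\<close> is the real-bilinear extension of \<open>E\<close>. The last condition says that \<open>\<Lambda>\<close> is its own
  dual with respect to \<open>F\<close>, i.e. that \<open>E\<close> is integral and unimodular on \<open>\<Lambda>\<close>.\<close>

definition ppav :: "('n::finite) torus \<Rightarrow> bool" where
  "ppav T \<longleftrightarrow> (case T of (\<Lambda>, E) \<Rightarrow>
     is_lattice \<Lambda> \<and>
     (\<exists>F. bilinear F \<and>
          (\<forall>u\<in>\<Lambda>. \<forall>v\<in>\<Lambda>. F u v = E u v) \<and>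
          (\<forall>u. F u u = 0) \<and>
          (\<forall>u v. F (\<i> *s u) (\<i> *s v) = F u v) \<and>
          (\<forall>u. u \<noteq> 0 \<longrightarrow> F (\<i> *s u) u > 0) \<and>
          {v. \<forall>u\<in>\<Lambda>. F u v \<in> \<int>} = \<Lambda>))"

definition polarized_iso :: "('n::finite) torus \<Rightarrow> 'n torus \<Rightarrow> bool" where
  "polarized_iso T T' \<longleftrightarrow> (case T of (\<Lambda>, E) \<Rightarrow> case T' of (\<Lambda>', E') \<Rightarrow>
     (\<exists>A::complex^'n^'n. invertible A \<and> (\<lambda>v. A *v v) ` \<Lambda> = \<Lambda>' \<and>
        (\<forall>u\<in>\<Lambda>. \<forall>v\<in>\<Lambda>. E' (A *v u) (A *v v) = E u v)))"

definition torus_prod :: "1 torus \<Rightarrow> 1 torus \<Rightarrow> 2 torus" where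
  "torus_prod T1 T2 = (case T1 of (\<Lambda>1, E1) \<Rightarrow> case T2 of (\<Lambda>2, E2) \<Rightarrow>
     ({u. vec (u $ 1) \<in> \<Lambda>1 \<and> vec (u $ 2) \<in> \<Lambda>2},
      \<lambda>u v. E1 (vec (u $ 1)) (vec (v $ 1)) + E2 (vec (u $ 2)) (vec (v $ 2))))"

text \<open>One-dimensional principally polarized abelian varieties are exactly the elliptic curves
  with their unique principal polarization.\<close>

definition reducible :: "2 torus \<Rightarrow> bool" where
  "reducible T \<longleftrightarrow> (\<exists>E1 E2 :: 1 torus. ppav E1 \<and> ppav E2 \<and> polarized_iso T (torus_prod E1 E2))"


section \<open>The abelian surfaces parametrized by the Hilbert modular surface\<close>

text \<open>The coefficient \<open>a\<close> of \<open>z\<close> runs through \<open>ring_of_ints D\<close> and the constant term \<open>b\<close> through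
  \<open>trace_dual D\<close>. With the roles of the two modules exchanged, the surface would be attached to
  \<open>SL(\<O>\<^sub>D \<oplus> \<O>\<^sub>D\<^sup>\<or>)\<close> rather than to \<open>SL_dual D\<close>: the isomorphism class would not be invariant under
  the translations \<open>z \<mapsto> z + b\<close>, \<open>b \<in> trace_dual D\<close>, so it would not be a function on \<open>X_surface D\<close>. With the
  present choice, the theta functions above are (up to a linear change of coordinates) those of
  the period matrix \<open>B\<^sup>T diag(z\<^sub>1, z\<^sub>2) B\<close> of this surface, where the columns of \<open>B\<close> are the
  embeddings of \<open>1\<close> and \<open>\<gamma>\<^sub>0\<close>.\<close>

definition surface_point :: "int \<Rightarrow> complex \<times> complex \<Rightarrow> real \<Rightarrow> real \<Rightarrow> complex^2" where
  "surface_point D z a b =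
     vector [of_real a * fst z + of_real b,
             of_real (quad_conj D a) * snd z + of_real (quad_conj D b)]"

definition surface_lattice :: "int \<Rightarrow> complex \<times> complex \<Rightarrow> (complex^2) set" where
  "surface_lattice D z =
     {surface_point D z a b |a b. a \<in> ring_of_ints D \<and> b \<in> trace_dual D}"

definition surface_form :: "int \<Rightarrow> complex \<times> complex \<Rightarrow> complex^2 \<Rightarrow> complex^2 \<Rightarrow> real" where
  "surface_form D z u v =
     (THE r. \<exists>a\<in>ring_of_ints D. \<exists>b\<in>trace_dual D. \<exists>a'\<in>ring_of_ints D. \<exists>b'\<in>trace_dual D.
        u = surface_point D z a b \<and> v = surface_point D z a' b' \<and>
        r = quad_trace D (a * b' - a' * b))"

definition surface :: "int \<Rightarrow> complex \<times> complex \<Rightarrow> 2 torus" where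
  "surface D z = (surface_lattice D z, surface_form D z)"

definition P_locus :: "int \<Rightarrow> (complex \<times> complex) set set" where
  "P_locus D = {c \<in> X_surface D. \<exists>z\<in>c. reducible (surface D z)}"

end

theory Submission
  imports Defs "HOL-Complex_Analysis.Complex_Analysis"
begin

text \<open>Multiplication by \<open>SL_dual D\<close> only changes the abelian surface by an isomorphism, so it suffices
  to show that the odd theta derivatives do not vanish at a point \<open>z\<close> whose surface is a product.
  In coordinates \<open>(s\<^sub>1, s\<^sub>2)\<close> adapted to the product, an odd theta function \<open>\<Theta>\<close> becomes, after
  multiplication by the exponential of a quadratic form, a section of degree 1 in each variable.
  Such sections form a line, so \<open>\<Theta>\<close> is a product of functions of \<open>s\<^sub>1\<close> and of \<open>s\<^sub>2\<close>. As \<open>\<Theta>\<close> is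
  odd, one factor is odd and the other even; as a section of degree 1 has no double zero, the
  differential of \<open>\<Theta>\<close> at 0 is a nonzero multiple of \<open>ds\<^sub>1\<close> or \<open>ds\<^sub>2\<close>. It can only vanish in the
  direction \<open>(0, 1)\<close> of the theta derivative if this direction is tangent to one of the two elliptic
  curves, which would give a nonzero lattice vector with first coordinate 0. But
  \<open>a z\<^sub>1 + b = 0\<close> with \<open>a, b\<close> real forces \<open>a = b = 0\<close>.\<close>

text \<open>The quadratic form comes from the polarization. Translation by a lattice vector
  multiplies \<Theta> by a constant times e of a linear form, and the alternation of these linear
  forms is the polarization. Orthogonality of the two elliptic curves makes the mixed terms
  symmetric, so a single quadratic form cancels the linear exponents at one period of each curve;
  the value -1 of the form on each curve leaves the factor e(-s) at the other period, which is
  degree 1. Sections are studied through Fourier coefficients alone: translation by \<tau> links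
  coefficients whose indices differ by the degree k, so k consecutive ones determine the section.
  Degree 1 gives the line; degree 2 gives the linear dependence that rules out double zeros. The two
  loci may be witnessed at different points of an orbit. Reducibility is what is carried from one
  point to the other, while the zero of \<open>D_theta\<close> stays where it is given.\<close>

no_notation fps_nth (infixl "$" 75)

section \<open>The exponential function\<close>

lemma e2pi_0 [simp]: "e2pi 0 = 1"
  by (simp add: e2pi_def)

lemma e2pi_nonzero [simp]: "e2pi z \<noteq> 0"
  by (simp add: e2pi_def)

lemma e2pi_add: "e2pi (z + w) = e2pi z * e2pi w"
  by (simp add: e2pi_def exp_add ring_distribs)

lemma e2pi_diff: "e2pi (z - w) = e2pi z / e2pi w"
  by (simp add: e2pi_def exp_diff ring_distribs)

lemma e2pi_minus: "e2pi (- z) = inverse (e2pi z)"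
  by (simp add: e2pi_def exp_minus)

lemma e2pi_of_int [simp]: "e2pi (of_int n) = 1"
  unfolding e2pi_def by (subst exp_eq_1) (auto intro!: exI[of _ n])

lemma e2pi_eq_1_iff: "e2pi z = 1 \<longleftrightarrow> z \<in> \<int>"
proof
  assume "e2pi z = 1"
  then obtain n :: int where "2 * pi * Re z = of_int (2 * n) * pi" "Im z = 0"
    unfolding e2pi_def exp_eq_1 by auto
  hence "z = of_int n" by (simp add: complex_eq_iff)
  thus "z \<in> \<int>" by simp
qed (auto elim: Ints_cases)

lemma norm_e2pi: "norm (e2pi z) = exp (- 2 * pi * Im z)"
  by (simp add: e2pi_def)

lemma e2pi_power: "e2pi z ^ n = e2pi (of_nat n * z)"
  by (simp add: e2pi_def flip: exp_of_nat_mult) (simp add: mult_ac)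

lemma has_field_derivative_e2pi [derivative_intros]:
  assumes "(f has_field_derivative f') (at x within S)"
  shows "((\<lambda>x. e2pi (f x)) has_field_derivative e2pi (f x) * (2 * of_real pi * \<i> * f')) (at x within S)"
  unfolding e2pi_def by (rule derivative_eq_intros assms refl | simp)+

lemma holomorphic_on_e2pi [holomorphic_intros]:
  "f holomorphic_on S \<Longrightarrow> (\<lambda>x. e2pi (f x)) holomorphic_on S"
  unfolding e2pi_def by (intro holomorphic_intros)

lemma e2pi_surj:
  assumes "c \<noteq> 0"
  obtains m where "c = e2pi m"
proof
  show "c = e2pi (Ln c / (2 * of_real pi * \<i>))"
    using assms by (simp add: e2pi_def)
qed

section \<open>Fourier coefficients of periodic entire functions\<close>

text \<open>For 1-periodic \<open>h\<close> this is the Fourier coefficient of index 0; the others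
  arise by inserting a factor \<open>e2pi (of_int n * s)\<close>. As a path integral it can be
  evaluated by complex primitives.\<close>

definition period_integral :: "(complex \<Rightarrow> complex) \<Rightarrow> complex" where
  "period_integral h = contour_integral (linepath 0 1) h"

lemma contour_integrable_entire:
  assumes "h holomorphic_on UNIV"
  shows "h contour_integrable_on linepath a b"
  by (rule contour_integrable_holomorphic_simple[OF assms]) auto

lemma entire_shift:
  assumes "h holomorphic_on UNIV"
  shows "(\<lambda>s. h (s + w)) holomorphic_on UNIV"
proof -
  have "(\<lambda>s. s + w) holomorphic_on UNIV" by (intro holomorphic_intros)
  from holomorphic_on_compose_gen[OF this assms] show ?thesis by (simp add: o_def)
qed

lemma period_integral_add:
  assumes "g holomorphic_on UNIV" "h holomorphic_on UNIV"
  shows "period_integral (\<lambda>s. g s + h s) = period_integral g + period_integral h"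
  unfolding period_integral_def by (intro contour_integral_add contour_integrable_entire assms)

lemma period_integral_cmult:
  assumes "h holomorphic_on UNIV"
  shows "period_integral (\<lambda>s. c * h s) = c * period_integral h"
  unfolding period_integral_def by (intro contour_integral_lmul contour_integrable_entire assms)

lemma period_integral_const [simp]: "period_integral (\<lambda>s. c) = c"
  by (simp add: period_integral_def)

text \<open>A primitive \<open>P\<close> turns the integral into \<open>P (w + 1) - P w\<close>,
  whose derivative in \<open>w\<close> vanishes by periodicity of \<open>h\<close>.\<close>

lemma period_integral_shift:
  assumes h: "h holomorphic_on UNIV" and per: "\<And>s. h (s + 1) = h s"
  shows "period_integral (\<lambda>s. h (s + w)) = period_integral h"
proof -
  obtain P where P: "\<And>s. (P has_field_derivative h s) (at s)"
    using holomorphic_convex_primitive'[OF convex_UNIV open_UNIV h] by auto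
  have *: "period_integral (\<lambda>s. h (s + w)) = P (w + 1) - P w" for w
  proof -
    have "((\<lambda>s. P (s + w)) has_field_derivative h (s + w)) (at s within UNIV)" for s
      using P DERIV_shift by blast
    from contour_integral_primitive[of UNIV "\<lambda>s. P (s + w)" "\<lambda>s. h (s + w)" "linepath 0 1"] this
    have "((\<lambda>s. h (s + w)) has_contour_integral P (1 + w) - P w) (linepath 0 1)"
      by simp
    thus ?thesis unfolding period_integral_def by (simp add: contour_integral_unique add.commute)
  qed
  have "\<exists>c. \<forall>w. P (w + 1) - P w = c"
  proof -
    have "((\<lambda>w. P (w + 1) - P w) has_field_derivative 0) (at w within UNIV)" for w
    proof -
      have "((\<lambda>w. P (w + 1)) has_field_derivative h (w + 1)) (at w)"
        using P DERIV_shift by blast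
      from DERIV_diff[OF this P[of w]] show ?thesis by (simp add: per)
    qed
    thus ?thesis using has_field_derivative_zero_constant[of UNIV "\<lambda>w. P (w + 1) - P w"] by auto
  qed
  then obtain c where "\<And>w. P (w + 1) - P w = c" by blast
  hence "period_integral (\<lambda>s. h (s + w)) = c" for w by (simp only: *)
  from this[of w] this[of 0] show ?thesis by simp
qed

lemma period_integral_bound:
  assumes h: "h holomorphic_on UNIV" and "\<And>x. x \<in> {0..1} \<Longrightarrow> norm (h (of_real x)) \<le> B"
  shows "norm (period_integral h) \<le> B"
proof -
  have "norm (period_integral h) \<le> B * norm (1 - 0 :: complex)"
    unfolding period_integral_def
  proof (rule contour_integral_bound_linepath[OF contour_integrable_entire[OF h]])
    show "0 \<le> B" using order_trans[OF norm_ge_zero assms(2)[of 0]] by simp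
    fix x assume "x \<in> closed_segment 0 (1::complex)"
    then obtain u where "0 \<le> u" "u \<le> 1" "x = of_real u"
      by (auto simp: in_segment scaleR_conv_of_real)
    thus "norm (h x) \<le> B" using assms(2)[of u] by simp
  qed
  thus ?thesis by simp
qed

text \<open>The kernel \<open>1 / (1 - e(s\<^sub>0 - s))\<close> expands into a geometric series below the line
  \<open>Im s = Im s\<^sub>0\<close> and into another one above it, and its residue at \<open>s\<^sub>0\<close> recovers \<open>g s\<^sub>0\<close>.
  Subtracting \<open>g s\<^sub>0\<close> first makes the quotient entire.\<close>

lemma kernel_quotient_entire:
  assumes g: "g holomorphic_on UNIV" and per: "\<And>s. g (s + 1) = g s"
  obtains q where "q holomorphic_on UNIV" "\<And>s. q (s + 1) = q s"
    "\<And>s. g s - g s0 = q s * (1 - e2pi (s0 - s))"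
proof -
  \<comment> \<open>The limit of the quotient at \<open>s0\<close>: the denominator has derivative 2
    pi i there.\<close>
  define L where "L = deriv g s0 / (2 * of_real pi * \<i>)"
  define q where "q s = (if s - s0 \<in> \<int> then L else (g s - g s0) / (1 - e2pi (s0 - s)))" for s
  have perZ: "g (s + of_int n) = g s" for s n
  proof -
    have nat: "g (s + of_nat n) = g s" for n s
    proof (induction n arbitrary: s)
      case (Suc n)
      have "g (s + of_nat (Suc n)) = g (s + of_nat n + 1)" by (simp add: add_ac)
      thus ?case using per Suc by metis
    qed simp
    show ?thesis
    proof (cases "n \<ge> 0")
      case True thus ?thesis using nat[of s "nat n"] by simp
    next
      case False thus ?thesis using nat[of "s + of_int n" "nat (-n)"] by simp
    qed
  qed
  have int: "s - s0 \<in> \<int> \<longleftrightarrow> e2pi (s0 - s) = 1" for s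
    using e2pi_eq_1_iff[of "s0 - s"] Ints_minus[of "s - s0"] Ints_minus[of "s0 - s"] by auto
  have eq: "g s - g s0 = q s * (1 - e2pi (s0 - s))" for s
  proof (cases "s - s0 \<in> \<int>")
    case True
    then obtain n where "s = s0 + of_int n" by (metis Ints_cases add.commute diff_add_cancel)
    thus ?thesis using True int[of s] by (simp add: perZ)
  qed (use int[of s] in \<open>simp add: q_def\<close>)
  have qper: "q (s + of_int n) = q s" for s n
  proof -
    have "s + of_int n - s0 \<in> \<int> \<longleftrightarrow> s - s0 \<in> \<int>"
      using Ints_add[OF _ Ints_of_int[of n], of "s - s0"] Ints_diff[OF _ Ints_of_int[of n], of "s + of_int n - s0"]
      by (auto simp: algebra_simps)
    moreover have "e2pi (s0 - (s + of_int n)) = e2pi (s0 - s)"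
      using e2pi_diff[of "s0 - s" "of_int n"] by (simp add: algebra_simps)
    ultimately show ?thesis by (simp add: q_def perZ)
  qed
  have q1: "q field_differentiable (at s)" if "s - s0 \<notin> \<int>" for s
  proof -
    have opn: "open {s. e2pi (s0 - s) \<noteq> 1}"
      unfolding e2pi_def by (intro open_Collect_neq continuous_intros)
    have "(\<lambda>s. (g s - g s0) / (1 - e2pi (s0 - s))) holomorphic_on {s. e2pi (s0 - s) \<noteq> 1}"
      by (intro holomorphic_intros holomorphic_on_subset[OF g]) auto
    hence "q holomorphic_on {s. e2pi (s0 - s) \<noteq> 1}"
      by (rule holomorphic_transform) (simp add: q_def int)
    thus ?thesis using that opn int by (auto simp: holomorphic_on_open field_differentiable_def)
  qed
  \<comment> \<open>Near \<open>s0\<close> numerator and denominator are both divided by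
    \<open>s - s0\<close>. On the unit disc no other translate of \<open>s0\<close> by an integer
    occurs, so the new denominator has no zero; the remaining points of \<open>s0\<close> + Z follow
    by periodicity.\<close>
  have q0: "q field_differentiable (at s0)"
  proof -
    define N where "N s = (if s = s0 then deriv g s0 else (g s - g s0) / (s - s0))" for s
    define E where "E s = (if s = s0 then deriv (\<lambda>s. - e2pi (s0 - s)) s0
                            else (- e2pi (s0 - s) - - e2pi (s0 - s0)) / (s - s0))" for s
    have N: "N holomorphic_on UNIV" unfolding N_def by (rule pole_lemma[OF g]) auto
    have E: "E holomorphic_on UNIV"
      unfolding E_def by (rule pole_lemma) (auto intro!: holomorphic_intros)
    have d: "deriv (\<lambda>s. - e2pi (s0 - s)) s0 = 2 * of_real pi * \<i>"
      by (rule DERIV_imp_deriv) (auto intro!: derivative_eq_intros)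
    have ball: "s - s0 \<notin> \<int>" if "s \<in> ball s0 1" "s \<noteq> s0" for s
    proof
      assume "s - s0 \<in> \<int>"
      then obtain n :: int where n: "s - s0 = of_int n" by (auto elim: Ints_cases)
      hence "norm (s - s0) = \<bar>of_int n\<bar>" by simp
      with that have "\<bar>real_of_int n\<bar> < 1" by (simp add: dist_norm norm_minus_commute)
      hence "n = 0" by linarith
      with n that show False by simp
    qed
    have nz: "E s \<noteq> 0" if "s \<in> ball s0 1" for s
      using ball[OF that] int[of s] by (auto simp: E_def d)
    have "(\<lambda>s. N s / E s) holomorphic_on ball s0 1"
      by (intro holomorphic_intros holomorphic_on_subset[OF N] holomorphic_on_subset[OF E]) (use nz in auto)
    hence "q holomorphic_on ball s0 1"
    proof (rule holomorphic_transform)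
      fix s assume s: "s \<in> ball s0 1"
      show "N s / E s = q s"
        using ball[OF s] by (auto simp: N_def E_def d q_def L_def)
    qed
    thus ?thesis by (simp add: holomorphic_on_imp_differentiable_at)
  qed
  have "q field_differentiable (at s)" for s
  proof (cases "s - s0 \<in> \<int>")
    case True
    then obtain n where n: "s = s0 + of_int n" by (metis Ints_cases add.commute diff_add_cancel)
    obtain d where "(q has_field_derivative d) (at s0)" using q0 by (auto simp: field_differentiable_def)
    hence "((\<lambda>x. q (x + - of_int n)) has_field_derivative d) (at (s0 + of_int n))"
      using DERIV_shift[of q d "s0 + of_int n" "- of_int n"] by simp
    moreover have "(\<lambda>x. q (x + - of_int n)) = q" using qper[of _ "-n"] by (simp add: fun_eq_iff)
    ultimately show ?thesis using n by (auto simp: field_differentiable_def)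
  qed (rule q1)
  hence "q holomorphic_on UNIV" by (simp add: holomorphic_on_def field_differentiable_at_within)
  thus thesis using that[of q] qper[of _ 1] eq by simp
qed

text \<open>Iterating q = h + q r gives q = h + h r + ... + h r^n + q r^(n+1). Only the first term
  has a nonzero integral, and the remainder is at most B \<rho>^(n+1) on the path.\<close>

lemma period_integral_geometric:
  assumes h: "h holomorphic_on UNIV" and q: "q holomorphic_on UNIV" and r: "r holomorphic_on UNIV"
    and eq: "\<And>s. h s = q s * (1 - r s)"
    and small: "\<And>x. x \<in> {0..1} \<Longrightarrow> norm (r (of_real x)) \<le> \<rho>" "\<rho> < 1"
    and coef: "\<And>n. period_integral (\<lambda>s. h s * r s ^ n) = (if n = 0 then c else 0)"
  shows "period_integral q = c"
proof -
  have rho: "\<rho> \<ge> 0" using order_trans[OF norm_ge_zero small(1)[of 0]] by simp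
  have step: "period_integral (\<lambda>s. q s * r s ^ n) = period_integral (\<lambda>s. h s * r s ^ n) + period_integral (\<lambda>s. q s * r s ^ Suc n)" for n
  proof -
    have "(\<lambda>s. q s * r s ^ n) = (\<lambda>s. h s * r s ^ n + q s * r s ^ Suc n)"
      by (simp add: fun_eq_iff eq algebra_simps)
    thus ?thesis by (simp only:) (intro period_integral_add holomorphic_intros h q r)
  qed
  have const: "period_integral q = c + period_integral (\<lambda>s. q s * r s ^ Suc n)" for n
  proof (induction n)
    case 0 show ?case using step[of 0] by (simp only: coef) simp
  next
    case (Suc n) thus ?case using step[of "Suc n"] by (simp only: coef) simp
  qed
  obtain B where B: "\<And>x. x \<in> {0..1} \<Longrightarrow> norm (q (of_real x)) \<le> B"
  proof -
    have "compact ((\<lambda>x. q (of_real x)) ` {0..1::real})"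
      by (intro compact_continuous_image continuous_intros
          continuous_on_compose2[OF holomorphic_on_imp_continuous_on[OF q]]) auto
    thus ?thesis using compact_imp_bounded bounded_iff that by (metis imageI)
  qed
  have "norm (period_integral q - c) \<le> B * \<rho> ^ Suc n" for n
  proof -
    have "norm (period_integral (\<lambda>s. q s * r s ^ Suc n)) \<le> B * \<rho> ^ Suc n"
    proof (rule period_integral_bound)
      fix x :: real assume x: "x \<in> {0..1}"
      show "norm (q (of_real x) * r (of_real x) ^ Suc n) \<le> B * \<rho> ^ Suc n"
        unfolding norm_mult norm_power
        by (intro mult_mono power_mono B small x) (use order_trans[OF norm_ge_zero B[OF x]] in auto)
    qed (intro holomorphic_intros q r)
    thus ?thesis using const[of n] by simp
  qed
  moreover have "(\<lambda>n. B * \<rho> ^ Suc n) \<longlonglongrightarrow> B * 0"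
    by (intro tendsto_mult tendsto_const LIMSEQ_Suc LIMSEQ_realpow_zero rho small)
  ultimately have "norm (period_integral q - c) \<le> 0"
    by (intro LIMSEQ_le_const[of "\<lambda>n. B * \<rho> ^ Suc n"]) auto
  thus ?thesis by simp
qed

lemma period_integral_e2pi: "period_integral (\<lambda>s. e2pi (of_int n * s)) = (if n = 0 then 1 else 0)"
proof (cases "n = 0")
  case False
  define k where "k = 2 * of_real pi * \<i> * of_int n"
  have k: "k \<noteq> 0" using False by (simp add: k_def)
  have "((\<lambda>s. e2pi (of_int n * s) / k) has_field_derivative e2pi (of_int n * s)) (at s)" for s
    using k by (auto intro!: derivative_eq_intros simp: k_def field_simps)
  from contour_integral_primitive[of UNIV _ _ "linepath 0 1", OF this]
  have "((\<lambda>s. e2pi (of_int n * s)) has_contour_integral 0) (linepath 0 1)" by simp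
  thus ?thesis using False by (simp add: period_integral_def contour_integral_unique)
qed simp

text \<open>The integral of the entire periodic quotient \<open>q\<close> is the same at every
  height. If all coefficients of \<open>g\<close> vanish, those of \<open>g - g s0\<close> reduce to
  \<open>- g s0\<close> at index 0; then the expansion below \<open>s0\<close> gives
  \<open>- g s0\<close> for the integral of \<open>q\<close>, and the one above gives 0.\<close>

lemma periodic_entire_eq_0:
  assumes g: "g holomorphic_on UNIV" and per: "\<And>s. g (s + 1) = g s"
    and coef: "\<And>n::int. period_integral (\<lambda>s. g s * e2pi (of_int n * s)) = 0"
  shows "g s0 = 0"
proof -
  obtain q where q: "q holomorphic_on UNIV" "\<And>s. q (s + 1) = q s"
    "\<And>s. g s - g s0 = q s * (1 - e2pi (s0 - s))"
    using kernel_quotient_entire[OF g per] by blast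
  have shift: "period_integral (\<lambda>s. (g (s + w) - g s0) * e2pi (of_int n * (s + w))) = (if n = 0 then - g s0 else 0)" for w n
  proof -
    have "period_integral (\<lambda>s. (g (s + w) - g s0) * e2pi (of_int n * (s + w)))
          = period_integral (\<lambda>s. (g s - g s0) * e2pi (of_int n * s))"
    proof (rule period_integral_shift)
      show "(g (s + 1) - g s0) * e2pi (of_int n * (s + 1)) = (g s - g s0) * e2pi (of_int n * s)" for s
        using per[of s] e2pi_add[of "of_int n * s" "of_int n"] by (simp add: ring_distribs)
    qed (intro holomorphic_intros g)
    also have "\<dots> = period_integral (\<lambda>s. g s * e2pi (of_int n * s) + (- g s0) * e2pi (of_int n * s))"
      by (simp add: algebra_simps)
    also have "\<dots> = period_integral (\<lambda>s. g s * e2pi (of_int n * s)) + (- g s0) * period_integral (\<lambda>s. e2pi (of_int n * s))"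
      by (subst period_integral_add, (intro holomorphic_intros g)+, subst period_integral_cmult) (auto intro: holomorphic_intros)
    finally show ?thesis by (simp add: coef period_integral_e2pi)
  qed
  have gh: "(\<lambda>s. g (s + w)) holomorphic_on UNIV" "(\<lambda>s. q (s + w)) holomorphic_on UNIV" for w
    using entire_shift g q(1) by blast+
  have "period_integral (\<lambda>s. q (s + (s0 - \<i>))) = - g s0"
  proof (rule period_integral_geometric)
    show "g (s + (s0 - \<i>)) - g s0 = q (s + (s0 - \<i>)) * (1 - e2pi (\<i> - s))" for s
      using q(3)[of "s + (s0 - \<i>)"] by (simp add: algebra_simps)
    show "norm (e2pi (\<i> - of_real x)) \<le> exp (- 2 * pi)" if "x \<in> {0..1}" for x
      by (simp add: norm_e2pi)
    show "period_integral (\<lambda>s. (g (s + (s0 - \<i>)) - g s0) * e2pi (\<i> - s) ^ n) = (if n = 0 then - g s0 else 0)" for n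
    proof -
      have "e2pi (\<i> - s) ^ n = e2pi (of_nat n * s0) * e2pi (of_int (- int n) * (s + (s0 - \<i>)))" for s
        by (simp add: e2pi_power ring_distribs flip: e2pi_add)
      hence "period_integral (\<lambda>s. (g (s + (s0 - \<i>)) - g s0) * e2pi (\<i> - s) ^ n)
        = period_integral (\<lambda>s. e2pi (of_nat n * s0) * ((g (s + (s0 - \<i>)) - g s0) * e2pi (of_int (- int n) * (s + (s0 - \<i>)))))"
        by (simp add: mult_ac)
      also have "\<dots> = e2pi (of_nat n * s0) * (if - int n = 0 then - g s0 else 0)"
        by (subst period_integral_cmult) (intro holomorphic_intros gh, subst shift, rule refl)
      finally show ?thesis by simp
    qed
  qed (auto intro!: holomorphic_intros gh)
  \<comment> \<open>Above \<open>s0\<close> the number e2pi (s0 - s) is large, so it is split off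
    from the kernel and the geometric series runs in its inverse.\<close>
  moreover have "period_integral (\<lambda>s. - (q (s + (s0 + \<i>)) * e2pi (- s - \<i>))) = - g s0"
  proof (rule period_integral_geometric)
    show "g (s + (s0 + \<i>)) - g s0 = - (q (s + (s0 + \<i>)) * e2pi (- s - \<i>)) * (1 - e2pi (s + \<i>))" for s
    proof -
      have 1: "e2pi (- s - \<i>) * e2pi (s + \<i>) = 1" by (simp flip: e2pi_add)
      have 2: "s0 - (s + (s0 + \<i>)) = - s - \<i>" by simp
      have "- (Q * E) * (1 - F) = Q * (E * F) - Q * E" for Q E F :: complex by (simp add: algebra_simps)
      thus ?thesis unfolding q(3)[of "s + (s0 + \<i>)"] 2 using 1 by (simp add: algebra_simps)
    qed
    show "norm (e2pi (of_real x + \<i>)) \<le> exp (- 2 * pi)" if "x \<in> {0..1}" for x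
      by (simp add: norm_e2pi)
    show "period_integral (\<lambda>s. (g (s + (s0 + \<i>)) - g s0) * e2pi (s + \<i>) ^ n) = (if n = 0 then - g s0 else 0)" for n
    proof -
      have "e2pi (s + \<i>) ^ n = e2pi (- of_nat n * s0) * e2pi (of_int (int n) * (s + (s0 + \<i>)))" for s
        by (simp add: e2pi_power ring_distribs flip: e2pi_add)
      hence "period_integral (\<lambda>s. (g (s + (s0 + \<i>)) - g s0) * e2pi (s + \<i>) ^ n)
        = period_integral (\<lambda>s. e2pi (- of_nat n * s0) * ((g (s + (s0 + \<i>)) - g s0) * e2pi (of_int (int n) * (s + (s0 + \<i>)))))"
        by (simp add: mult_ac)
      also have "\<dots> = e2pi (- of_nat n * s0) * (if int n = 0 then - g s0 else 0)"
        by (subst period_integral_cmult) (intro holomorphic_intros gh, subst shift, rule refl)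
      finally show ?thesis by simp
    qed
  qed (auto intro!: holomorphic_intros gh)
  moreover have "period_integral (\<lambda>s. q (s + w)) = period_integral q" for w
    by (rule period_integral_shift[OF q(1,2)])
  \<comment> \<open>Undoes the splitting: the split-off part contributes \<open>g s0\<close>, which
    cancels the integral of \<open>g - g s0\<close>.\<close>
  moreover have "period_integral (\<lambda>s. q (s + (s0 + \<i>))) = period_integral (\<lambda>s. g (s + (s0 + \<i>)) - g s0)
      + period_integral (\<lambda>s. q (s + (s0 + \<i>)) * e2pi (- s - \<i>))"
  proof -
    have "q (s + (s0 + \<i>)) = (g (s + (s0 + \<i>)) - g s0) + q (s + (s0 + \<i>)) * e2pi (- s - \<i>)" for s
    proof -
      have "s0 - (s + (s0 + \<i>)) = - s - \<i>" by simp
      thus ?thesis using q(3)[of "s + (s0 + \<i>)"] by (simp only:) (simp add: ring_distribs)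
    qed
    thus ?thesis
      by (subst period_integral_add[symmetric]) (auto intro!: holomorphic_intros gh)
  qed
  moreover have "period_integral (\<lambda>s. g (s + (s0 + \<i>)) - g s0) = - g s0"
    using shift[of "s0 + \<i>" 0] by simp
  moreover have "period_integral (\<lambda>s. - (q (s + (s0 + \<i>)) * e2pi (- s - \<i>)))
      = - period_integral (\<lambda>s. q (s + (s0 + \<i>)) * e2pi (- s - \<i>))"
    using period_integral_cmult[of "\<lambda>s. q (s + (s0 + \<i>)) * e2pi (- s - \<i>)" "-1"]
    by (simp add: holomorphic_intros gh)
  ultimately show ?thesis by simp
qed

section \<open>Sections of line bundles on an elliptic curve\<close>

text \<open>For Im \<tau> > 0 these are the sections of a line bundle of degree \<open>k\<close> on
  the elliptic curve with periods 1 and \<tau>, pulled back to the plane; \<open>c\<close> and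
  \<open>d\<close> select the bundle.\<close>

definition quasi_periodic :: "complex \<Rightarrow> nat \<Rightarrow> complex \<Rightarrow> complex \<Rightarrow> (complex \<Rightarrow> complex) \<Rightarrow> bool" where
  "quasi_periodic \<tau> k c d g \<longleftrightarrow> g holomorphic_on UNIV \<and>
     (\<forall>s. g (s + 1) = c * g s) \<and> (\<forall>s. g (s + \<tau>) = d * e2pi (- (of_nat k * s)) * g s)"

lemma quasi_periodic_lincomb:
  assumes "quasi_periodic \<tau> k c d g" "quasi_periodic \<tau> k c d h"
  shows "quasi_periodic \<tau> k c d (\<lambda>s. x * g s + y * h s)"
  using assms unfolding quasi_periodic_def
  by (auto intro!: holomorphic_intros simp: algebra_simps)

text \<open>Makes the section 1-periodic, so that its Fourier coefficients are available.\<close>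

lemma quasi_periodic_twist:
  assumes "quasi_periodic \<tau> k (e2pi m) d g"
  shows "quasi_periodic \<tau> k 1 (d * e2pi (- (m * \<tau>))) (\<lambda>s. g s * e2pi (- (m * s)))"
  using assms unfolding quasi_periodic_def
  by (auto intro!: holomorphic_intros simp: ring_distribs e2pi_add e2pi_diff e2pi_minus field_simps)

text \<open>Moving the path by \<tau> expresses the coefficient of index \<open>n\<close> as a
  nonzero multiple of that of index \<open>n - k\<close>, so the vanishing of \<open>k\<close>
  consecutive coefficients spreads to all.\<close>

lemma quasi_periodic_eq_0:
  assumes g: "quasi_periodic \<tau> k 1 d g" and "d \<noteq> 0" "k > 0"
    and coef: "\<And>n. n \<in> {0..<int k} \<Longrightarrow> period_integral (\<lambda>s. g s * e2pi (of_int n * s)) = 0"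
  shows "g s = 0"
proof -
  define C where "C n = period_integral (\<lambda>s. g s * e2pi (of_int n * s))" for n
  have hol: "g holomorphic_on UNIV" and per: "\<And>s. g (s + 1) = g s"
    and tau: "\<And>s. g (s + \<tau>) = d * e2pi (- (of_nat k * s)) * g s"
    using g by (auto simp: quasi_periodic_def)
  have rec: "C n = d * e2pi (of_int n * \<tau>) * C (n - int k)" for n
  proof -
    have "C n = period_integral (\<lambda>s. g (s + \<tau>) * e2pi (of_int n * (s + \<tau>)))"
      unfolding C_def
    proof (rule period_integral_shift[symmetric])
      show "g (s + 1) * e2pi (of_int n * (s + 1)) = g s * e2pi (of_int n * s)" for s
        by (simp add: per ring_distribs e2pi_add)
    qed (intro holomorphic_intros hol)
    also have "\<dots> = period_integral (\<lambda>s. d * e2pi (of_int n * \<tau>) * (g s * e2pi (of_int (n - int k) * s)))"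
      by (simp add: tau ring_distribs e2pi_add e2pi_diff e2pi_minus field_simps)
    also have "\<dots> = d * e2pi (of_int n * \<tau>) * C (n - int k)"
      unfolding C_def by (intro period_integral_cmult holomorphic_intros hol)
    finally show ?thesis .
  qed
  have up: "C n = 0 \<longleftrightarrow> C (n - int k) = 0" for n
    using rec[of n] \<open>d \<noteq> 0\<close> by simp
  have nat: "C (n + int k * int j) = 0 \<longleftrightarrow> C n = 0" for n j
  proof (induction j)
    case (Suc j) thus ?case using up[of "n + int k * int (Suc j)"] by (simp add: algebra_simps)
  qed simp
  have "C n = 0" for n
  proof -
    have "C (n mod int k) = 0"
      unfolding C_def using \<open>k > 0\<close> by (intro coef) auto
    moreover have "n = n mod int k + int k * (n div int k)" by simp
    ultimately show ?thesis
      using nat[of "n mod int k" "nat (n div int k)"] nat[of n "nat (- (n div int k))"]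
      by (cases "n div int k \<ge> 0") (simp_all add: algebra_simps minus_mult_div_eq_mod)
  qed
  thus ?thesis using periodic_entire_eq_0[OF hol per] by (simp add: C_def)
qed

text \<open>After the twist one coefficient determines a section, so a combination of
  \<open>G\<close> and \<open>K\<close> whose integral vanishes is zero. Cross-multiplication also
  covers the zero section.\<close>

lemma quasi_periodic_1_proportional:
  assumes g: "quasi_periodic \<tau> 1 c d g" and h: "quasi_periodic \<tau> 1 c d h"
    and "c \<noteq> 0" "d \<noteq> 0"
  shows "g s * h t = g t * h s"
proof -
  obtain m where m: "c = e2pi m" using e2pi_surj \<open>c \<noteq> 0\<close> by blast
  define D where "D = d * e2pi (- (m * \<tau>))"
  define G where "G s = g s * e2pi (- (m * s))" for s
  define K where "K s = h s * e2pi (- (m * s))" for s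
  have G: "quasi_periodic \<tau> 1 1 D G" and K: "quasi_periodic \<tau> 1 1 D K"
    using quasi_periodic_twist g h unfolding m D_def G_def K_def by blast+
  hence hol: "G holomorphic_on UNIV" "K holomorphic_on UNIV" by (auto simp: quasi_periodic_def)
  have D: "D \<noteq> 0" using \<open>d \<noteq> 0\<close> by (simp add: D_def)
  have lin: "x * G s + y * K s = 0" if "x * period_integral G + y * period_integral K = 0" for x y s
  proof (rule quasi_periodic_eq_0[OF quasi_periodic_lincomb[OF G K] D])
    fix n :: int assume "n \<in> {0..<int 1}"
    hence "n = 0" by simp
    hence "period_integral (\<lambda>s. (x * G s + y * K s) * e2pi (of_int n * s)) = period_integral (\<lambda>s. x * G s + y * K s)"
      by simp
    also have "\<dots> = x * period_integral G + y * period_integral K"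
      by (simp add: period_integral_add period_integral_cmult holomorphic_intros hol)
    finally show "period_integral (\<lambda>s. (x * G s + y * K s) * e2pi (of_int n * s)) = 0" using that by simp
  qed simp
  have "G s * K t = G t * K s"
  proof (cases "period_integral G = 0")
    case True
    with lin[of 1 0] show ?thesis by simp
  next
    case False
    have "period_integral G * K s = period_integral K * G s" for s using lin[of "- period_integral K" "period_integral G" s] by simp
    from this[of s] this[of t] have "period_integral G * (G s * K t) = period_integral G * (G t * K s)"
      by (metis mult.assoc mult.commute)
    with False show ?thesis by simp
  qed
  thus ?thesis by (simp add: G_def K_def)
qed

section \<open>Sections of degree 2 and double zeros in degree 1\<close>

text \<open>The cross product is a solution; if it vanishes, the two coefficient vectors are
  proportional and a solution of one equation suffices.\<close>

lemma ex_orthogonal3: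
  fixes a1 a2 a3 b1 b2 b3 :: "'a::field"
  obtains x y z where "(x, y, z) \<noteq> (0, 0, 0)"
    "x * a1 + y * a2 + z * a3 = 0" "x * b1 + y * b2 + z * b3 = 0"
proof (cases "a1 = 0 \<and> a2 = 0 \<and> a3 = 0")
  case True
  show thesis
  proof (cases "b1 = 0")
    case True with \<open>a1 = 0 \<and> _\<close> show thesis by (intro that[of 1 0 0]) auto
  next
    case False with True show thesis by (intro that[of "- b2" b1 0]) auto
  qed
next
  case a: False
  show thesis
  proof (cases "a2 * b3 - a3 * b2 = 0 \<and> a3 * b1 - a1 * b3 = 0 \<and> a1 * b2 - a2 * b1 = 0")
    case False
    thus thesis
      by (intro that[of "a2 * b3 - a3 * b2" "a3 * b1 - a1 * b3" "a1 * b2 - a2 * b1"])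
         (auto simp: algebra_simps)
  next
    case True
    hence e: "a2 * b3 = a3 * b2" "a3 * b1 = a1 * b3" "a1 * b2 = a2 * b1" by auto
    show thesis
    proof (cases "a1 = 0")
      case False
      with e show thesis by (intro that[of "- a2" a1 0]) (auto simp: algebra_simps)
    next
      case z1: True
      show thesis
      proof (cases "a2 = 0")
        case False with z1 e show thesis by (intro that[of 1 0 0]) auto
      next
        case True with z1 e a show thesis by (intro that[of 1 0 0]) auto
      qed
    qed
  qed
qed

text \<open>Two coefficients determine a section of degree 2, and three vectors in a plane are
  dependent.\<close>

lemma quasi_periodic_2_dependent:
  assumes g: "quasi_periodic \<tau> 2 c d g1" "quasi_periodic \<tau> 2 c d g2" "quasi_periodic \<tau> 2 c d g3"
    and "c \<noteq> 0" "d \<noteq> 0"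
  obtains x y z where "(x, y, z) \<noteq> (0, 0, 0)" "\<And>s. x * g1 s + y * g2 s + z * g3 s = 0"
proof -
  obtain m where m: "c = e2pi m" using e2pi_surj \<open>c \<noteq> 0\<close> by blast
  define D where "D = d * e2pi (- (m * \<tau>))"
  define T where "T g s = g s * e2pi (- (m * s))" for g s
  define C where "C g n = period_integral (\<lambda>s. T g s * e2pi (of_int n * s))" for g and n :: int
  have T: "quasi_periodic \<tau> 2 1 D (T g1)" "quasi_periodic \<tau> 2 1 D (T g2)" "quasi_periodic \<tau> 2 1 D (T g3)"
    using quasi_periodic_twist g unfolding m D_def T_def by blast+
  hence hol: "T g1 holomorphic_on UNIV" "T g2 holomorphic_on UNIV" "T g3 holomorphic_on UNIV"
    by (auto simp: quasi_periodic_def)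
  have D: "D \<noteq> 0" using \<open>d \<noteq> 0\<close> by (simp add: D_def)
  obtain x y z where xyz: "(x, y, z) \<noteq> (0, 0, 0)"
    "x * C g1 0 + y * C g2 0 + z * C g3 0 = 0" "x * C g1 1 + y * C g2 1 + z * C g3 1 = 0"
    by (rule ex_orthogonal3[of "C g1 0" "C g2 0" "C g3 0" "C g1 1" "C g2 1" "C g3 1"])
  have "x * T g1 s + y * T g2 s + z * T g3 s = 0" for s
  proof -
    have q: "quasi_periodic \<tau> 2 1 D (\<lambda>s. 1 * (x * T g1 s + y * T g2 s) + z * T g3 s)"
      by (intro quasi_periodic_lincomb T)
    have "1 * (x * T g1 s + y * T g2 s) + z * T g3 s = 0"
    proof (rule quasi_periodic_eq_0[OF q D])
      fix n :: int assume "n \<in> {0..<int 2}"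
      hence n: "n = 0 \<or> n = 1" by auto
      have "period_integral (\<lambda>s. (1 * (x * T g1 s + y * T g2 s) + z * T g3 s) * e2pi (of_int n * s)) =
            period_integral (\<lambda>s. (x * (T g1 s * e2pi (of_int n * s)) + y * (T g2 s * e2pi (of_int n * s)))
                  + z * (T g3 s * e2pi (of_int n * s)))"
        by (simp add: algebra_simps)
      also have "\<dots> = x * C g1 n + y * C g2 n + z * C g3 n"
        unfolding C_def by (simp add: period_integral_add period_integral_cmult holomorphic_intros hol)
      also have "\<dots> = 0" using n xyz by auto
      finally show "period_integral (\<lambda>s. (1 * (x * T g1 s + y * T g2 s) + z * T g3 s) * e2pi (of_int n * s)) = 0" .
    qed simp
    thus ?thesis by simp
  qed
  moreover have "x * T g1 s + y * T g2 s + z * T g3 s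
      = (x * g1 s + y * g2 s + z * g3 s) * e2pi (- (m * s))" for s
    by (simp add: T_def algebra_simps)
  ultimately have "x * g1 s + y * g2 s + z * g3 s = 0" for s by simp
  with xyz show thesis using that by blast
qed

text \<open>The shifts by \<open>a\<close> and \<open>- a\<close> cancel in the product of the
  multipliers, so all these functions are sections of the same bundle, whatever \<open>a\<close>
  is.\<close>

lemma quasi_periodic_shift_product:
  assumes g: "quasi_periodic \<tau> 1 c d g"
  shows "quasi_periodic \<tau> 2 (c\<^sup>2) (d\<^sup>2) (\<lambda>s. g (s + a) * g (s - a))"
proof -
  have hol: "g holomorphic_on UNIV" and per: "\<And>s. g (s + 1) = c * g s"
    and tau: "\<And>s. g (s + \<tau>) = d * e2pi (- s) * g s"
    using g by (auto simp: quasi_periodic_def)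
  have "g (s + 1 + a) = c * g (s + a)" "g (s + 1 - a) = c * g (s - a)" for s
    using per[of "s + a"] per[of "s - a"] by (simp_all add: algebra_simps)
  moreover have "g (s + \<tau> + a) = d * e2pi (- (s + a)) * g (s + a)"
    "g (s + \<tau> - a) = d * e2pi (- (s - a)) * g (s - a)" for s
    using tau[of "s + a"] tau[of "s - a"] by (simp_all add: algebra_simps)
  moreover have "e2pi (- (s + a)) * e2pi (- (s - a)) = e2pi (- (2 * s))" for s
    by (simp flip: e2pi_add)
  moreover have "(\<lambda>s. g (s + a) * g (s - a)) holomorphic_on UNIV"
    using entire_shift[OF hol, of a] entire_shift[OF hol, of "-a"] by (auto intro!: holomorphic_intros)
  ultimately show ?thesis
    unfolding quasi_periodic_def by (simp add: power2_eq_square mult_ac)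
qed

text \<open>This is \<open>g\<^sup>2\<close> times the second logarithmic derivative of \<open>g\<close>.\<close>

lemma quasi_periodic_log_deriv2:
  assumes g: "quasi_periodic \<tau> 1 c d g"
  shows "quasi_periodic \<tau> 2 (c\<^sup>2) (d\<^sup>2) (\<lambda>s. deriv (deriv g) s * g s - (deriv g s)\<^sup>2)"
proof -
  have hol: "g holomorphic_on UNIV" and per: "\<And>s. g (s + 1) = c * g s"
    and tau: "\<And>s. g (s + \<tau>) = d * e2pi (- s) * g s"
    using g by (auto simp: quasi_periodic_def)
  have hol1: "deriv g holomorphic_on UNIV" and hol2: "deriv (deriv g) holomorphic_on UNIV"
    using hol by (auto intro: holomorphic_deriv)
  define \<kappa> where "\<kappa> = 2 * of_real pi * \<i>"
  have D1: "(g has_field_derivative deriv g s) (at s)"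
    and D2: "(deriv g has_field_derivative deriv (deriv g) s) (at s)" for s
    using hol hol1 by (auto intro: holomorphic_derivI)
  \<comment> \<open>Differentiates a functional equation for translates; it is applied to each
    period, first for \<open>g\<close> and then for \<open>deriv g\<close>.\<close>
  have shift: "(\<lambda>s. f (s + w)) = h \<Longrightarrow> (h has_field_derivative h') (at s) \<Longrightarrow>
      (\<And>s. (f has_field_derivative f' s) (at s)) \<Longrightarrow> f' (s + w) = h'" for f f' h :: "complex \<Rightarrow> complex" and h' w s
    by (metis DERIV_shift DERIV_unique)
  have per1: "deriv g (s + 1) = c * deriv g s" for s
    by (rule shift[OF _ _ D1]) (auto simp: fun_eq_iff per intro!: derivative_eq_intros D1)
  have per2: "deriv (deriv g) (s + 1) = c * deriv (deriv g) s" for s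
    by (rule shift[OF _ _ D2]) (auto simp: fun_eq_iff per1 intro!: derivative_eq_intros D2)
  have tau1: "deriv g (s + \<tau>) = d * e2pi (- s) * (deriv g s - \<kappa> * g s)" for s
    by (rule shift[OF _ _ D1])
      (auto simp: fun_eq_iff tau \<kappa>_def algebra_simps intro!: derivative_eq_intros D1)
  have tau2: "deriv (deriv g) (s + \<tau>) = d * e2pi (- s) * (deriv (deriv g) s - 2 * \<kappa> * deriv g s + \<kappa>\<^sup>2 * g s)" for s
  proof (rule shift[OF _ _ D2])
    show "(\<lambda>s. deriv g (s + \<tau>)) = (\<lambda>s. d * e2pi (- s) * (deriv g s - \<kappa> * g s))"
      by (simp add: fun_eq_iff tau1)
    have "((\<lambda>s. e2pi (- s)) has_field_derivative - \<kappa> * e2pi (- s)) (at s)"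
      by (auto intro!: derivative_eq_intros simp: \<kappa>_def)
    from DERIV_cmult[OF DERIV_mult[OF this DERIV_diff[OF D2 DERIV_cmult[OF D1]]], of d \<kappa>]
    show "((\<lambda>s. d * e2pi (- s) * (deriv g s - \<kappa> * g s)) has_field_derivative
      d * e2pi (- s) * (deriv (deriv g) s - 2 * \<kappa> * deriv g s + \<kappa>\<^sup>2 * g s)) (at s)"
      by (rule back_subst[of "\<lambda>x. x"]) (simp add: algebra_simps power2_eq_square)
  qed
  have e: "e2pi (- (2 * s)) = (e2pi (- s))\<^sup>2" for s
    by (simp add: power2_eq_square flip: e2pi_add)
  show ?thesis
    unfolding quasi_periodic_def
    by (auto intro!: holomorphic_intros hol hol1 hol2
        simp: per per1 per2 tau tau1 tau2 e) (simp_all add: power2_eq_square algebra_simps)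
qed

lemma entire_eq_0:
  assumes "h holomorphic_on UNIV" "open U" "u \<in> U" "\<And>s. s \<in> U \<Longrightarrow> h s = 0"
  shows "h s = 0"
  using analytic_continuation_open[of U UNIV h "\<lambda>_. 0" s] assms by auto

text \<open>The functions \<open>g\<^sup>2\<close>, \<open>g'' g - g'\<^sup>2\<close> and \<open>g(s + a) g(s - a)\<close> are sections of degree 2, hence
  dependent. At a double zero of \<open>g\<close> the first two vanish but, for suitable \<open>a\<close>, the third does not.
  So \<open>g'' g - g'\<^sup>2 = \<kappa> g\<^sup>2\<close>, and a nonzero solution of this equation has no zeros.\<close>

lemma quasi_periodic_1_no_double_zero:
  assumes g: "quasi_periodic \<tau> 1 c d g" and cd: "c \<noteq> 0" "d \<noteq> 0"
    and "g p \<noteq> 0" and z: "g 0 = 0" "deriv g 0 = 0"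
  shows False
proof -
  have hol: "g holomorphic_on UNIV" using g by (auto simp: quasi_periodic_def)
  have hol1: "deriv g holomorphic_on UNIV" and hol2: "deriv (deriv g) holomorphic_on UNIV"
    using hol by (auto intro: holomorphic_deriv)
  have D1: "(g has_field_derivative deriv g s) (at s)"
    and D2: "(deriv g has_field_derivative deriv (deriv g) s) (at s)" for s
    using hol hol1 by (auto intro: holomorphic_derivI)
  have cont: "continuous_on UNIV g" by (rule holomorphic_on_imp_continuous_on[OF hol])
  have avoid: "\<exists>e>0. \<forall>s\<in>ball p e. g s \<noteq> 0"
    using continuous_on_open_avoid[OF cont open_UNIV UNIV_I \<open>g p \<noteq> 0\<close>] by (auto simp: ball_def)
  \<comment> \<open>Otherwise \<open>g\<close> would vanish near \<open>- p\<close>, because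
    \<open>g (- s)\<close> does not vanish there, and hence everywhere.\<close>
  obtain a where a: "g a * g (- a) \<noteq> 0"
  proof (rule ccontr)
    assume "\<not> thesis"
    hence all: "g a * g (- a) = 0" for a using that by blast
    obtain e where e: "e > 0" "\<And>s. s \<in> ball p e \<Longrightarrow> g s \<noteq> 0"
      using avoid by blast
    have "g s = 0" if "s \<in> ball (- p) e" for s
    proof -
      have "dist p (- s) = dist (- p) s" by (metis dist_minus minus_minus)
      hence "- s \<in> ball p e" using that by simp
      with e all[of s] show ?thesis by simp
    qed
    hence "g p = 0"
      by (rule entire_eq_0[OF hol open_ball centre_in_ball[THEN iffD2, OF e(1)]])
    with \<open>g p \<noteq> 0\<close> show False by simp
  qed
  let ?H = "\<lambda>s. deriv (deriv g) s * g s - (deriv g s)\<^sup>2"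
  obtain x y w where xyw: "(x, y, w) \<noteq> (0, 0, 0)"
    "\<And>s. x * (g (s + 0) * g (s - 0)) + y * ?H s + w * (g (s + a) * g (s - a)) = 0"
    using quasi_periodic_2_dependent[OF quasi_periodic_shift_product[OF g, of 0]
        quasi_periodic_log_deriv2[OF g] quasi_periodic_shift_product[OF g, of a]] cd by auto
  \<comment> \<open>At the double zero 0 only the third section survives.\<close>
  have w: "w = 0" using xyw(2)[of 0] a z by simp
  have "y \<noteq> 0" using xyw(2)[of p] xyw(1) w \<open>g p \<noteq> 0\<close> by auto
  define \<kappa> where "\<kappa> = - x / y"
  have H: "deriv (deriv g) s * g s - (deriv g s)\<^sup>2 = \<kappa> * (g s)\<^sup>2" for s
    using xyw(2)[of s] w \<open>y \<noteq> 0\<close> by (simp add: \<kappa>_def field_simps power2_eq_square)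
  define \<mu> where "\<mu> = deriv g p / g p"
  obtain e where e: "e > 0" "\<And>s. s \<in> ball p e \<Longrightarrow> g s \<noteq> 0"
    using avoid by blast
  \<comment> \<open>The equation \<open>H\<close> says that the logarithmic derivative of
    \<open>g\<close> has constant derivative \<kappa> where \<open>g\<close> has no zero.\<close>
  have loc: "deriv g s / g s - \<kappa> * (s - p) = \<mu>" if s: "s \<in> ball p e" for s
  proof -
    have "((\<lambda>s. deriv g s / g s - \<kappa> * (s - p)) has_field_derivative 0) (at s within ball p e)"
      if "s \<in> ball p e" for s
      using H[of s] e(2)[OF that]
      by (auto intro!: derivative_eq_intros D1[THEN DERIV_subset] D2[THEN DERIV_subset]
          simp: field_simps power2_eq_square)
    then obtain K where K: "\<And>s. s \<in> ball p e \<Longrightarrow> deriv g s / g s - \<kappa> * (s - p) = K"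
      using has_field_derivative_zero_constant[of "ball p e" "\<lambda>s. deriv g s / g s - \<kappa> * (s - p)"] by auto
    from K[OF s] K[of p] e(1) show ?thesis by (simp add: \<mu>_def)
  qed
  have "deriv g s - (\<kappa> * (s - p) + \<mu>) * g s = 0" for s
  proof (rule entire_eq_0[of "\<lambda>s. deriv g s - (\<kappa> * (s - p) + \<mu>) * g s" "ball p e" p])
    show "(\<lambda>s. deriv g s - (\<kappa> * (s - p) + \<mu>) * g s) holomorphic_on UNIV"
      by (intro holomorphic_intros hol hol1)
    show "deriv g z - (\<kappa> * (z - p) + \<mu>) * g z = 0" if "z \<in> ball p e" for z
      using loc[OF that] e(2)[OF that] by (auto simp: field_simps)
    show "p \<in> ball p e" using e(1) by simp
  qed simp
  \<comment> \<open>Half of \<kappa>, so that the factor in the differential equation is the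
    derivative of \<nu> (s - p)^2 + \<mu> (s - p).\<close>
  moreover obtain \<nu> where "\<kappa> = 2 * \<nu>" using that[of "\<kappa> / 2"] by simp
  ultimately have ode: "deriv g s = (2 * \<nu> * (s - p) + \<mu>) * g s" for s by (simp add: mult.commute)
  have "((\<lambda>s. g s * exp (- (\<nu> * (s - p)\<^sup>2 + \<mu> * (s - p)))) has_field_derivative 0) (at s within UNIV)" for s
    by (auto intro!: derivative_eq_intros D1 simp: ode algebra_simps)
  then obtain K where K: "\<And>s. g s * exp (- (\<nu> * (s - p)\<^sup>2 + \<mu> * (s - p))) = K"
    using has_field_derivative_zero_constant[of UNIV "\<lambda>s. g s * exp (- (\<nu> * (s - p)\<^sup>2 + \<mu> * (s - p)))"]
    by auto
  from K[of 0] K[of p] z \<open>g p \<noteq> 0\<close> show False by simp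
qed

section \<open>Odd functions of degree 1 on a product of two elliptic curves\<close>

text \<open>\<open>A\<close>, \<open>B\<close>, \<open>C\<close> are the linear forms of the
  automorphy factors evaluated on the first periods of the two curves. That the same
  \<open>B\<close> occurs in both variables is orthogonality of the curves, and the two summands
  \<open>+ 1\<close> are the principal polarizations.\<close>

lemma odd_degree_1_theta_derivative_nonzero:
  fixes H :: "complex \<Rightarrow> complex \<Rightarrow> complex"
  assumes hol1: "\<And>s2. (\<lambda>s1. H s1 s2) holomorphic_on UNIV"
    and hol2: "\<And>s1. (\<lambda>s2. H s1 s2) holomorphic_on UNIV"
    and odd: "\<And>s1 s2. H (- s1) (- s2) = - H s1 s2"
    and nz: "H \<alpha> \<beta> \<noteq> 0"
    and k: "k1 \<noteq> 0" "k2 \<noteq> 0" "k3 \<noteq> 0" "k4 \<noteq> 0"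
    and p1: "\<And>s1 s2. H (s1 + 1) s2 = k1 * e2pi (- (A * s1 + B * s2)) * H s1 s2"
    and p2: "\<And>s1 s2. H s1 (s2 + 1) = k2 * e2pi (- (B * s1 + C * s2)) * H s1 s2"
    and q1: "\<And>s1 s2. H (s1 + \<tau>1) s2 = k3 * e2pi (- ((\<tau>1 * A + 1) * s1 + \<tau>1 * B * s2)) * H s1 s2"
    and q2: "\<And>s1 s2. H s1 (s2 + \<tau>2) = k4 * e2pi (- (\<tau>2 * B * s1 + (\<tau>2 * C + 1) * s2)) * H s1 s2"
    and x: "x1 \<noteq> 0" "x2 \<noteq> 0"
    and D: "((\<lambda>t. H (x1 * t) (x2 * t)) has_field_derivative D) (at 0)"
  shows "D \<noteq> 0"
proof -
  \<comment> \<open>Up to constants, the increments of \<open>Q\<close> under \<open>s1 + 1\<close>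
    and \<open>s2 + 1\<close> are exactly the linear exponents in \<open>p1\<close> and
    \<open>p2\<close>; under the \<tau>-periods they leave only the exponent of degree 1.\<close>
  define Q where "Q s1 s2 = (A * s1\<^sup>2 + 2 * B * s1 * s2 + C * s2\<^sup>2) / 2" for s1 s2
  define G where "G s1 s2 = H s1 s2 * e2pi (Q s1 s2)" for s1 s2
  have qp1: "quasi_periodic \<tau>1 1 (k1 * e2pi (A / 2)) (k3 * e2pi (A * \<tau>1\<^sup>2 / 2)) (\<lambda>s. G s s2)" for s2
  proof -
    have e1: "e2pi (- (A * s + B * s2)) * e2pi (Q (s + 1) s2) = e2pi (A / 2) * e2pi (Q s s2)" for s
      unfolding e2pi_add[symmetric] by (rule arg_cong[of _ _ e2pi]) (simp add: Q_def field_simps power2_eq_square)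
    have e2: "e2pi (- ((\<tau>1 * A + 1) * s + \<tau>1 * B * s2)) * e2pi (Q (s + \<tau>1) s2)
        = e2pi (A * \<tau>1\<^sup>2 / 2) * e2pi (- s) * e2pi (Q s s2)" for s
      unfolding e2pi_add[symmetric] by (rule arg_cong[of _ _ e2pi]) (simp add: Q_def field_simps power2_eq_square)
    show ?thesis
      unfolding quasi_periodic_def
    proof (intro conjI allI)
      show "(\<lambda>s. G s s2) holomorphic_on UNIV"
        unfolding G_def Q_def by (intro holomorphic_intros hol1) auto
      show "G (s + 1) s2 = k1 * e2pi (A / 2) * G s s2" for s
        unfolding G_def p1 using e1[of s] by (simp add: mult_ac)
      show "G (s + \<tau>1) s2 = k3 * e2pi (A * \<tau>1\<^sup>2 / 2) * e2pi (- (of_nat 1 * s)) * G s s2" for s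
        unfolding G_def q1 using e2[of s] by (simp add: mult_ac)
    qed
  qed
  have qp2: "quasi_periodic \<tau>2 1 (k2 * e2pi (C / 2)) (k4 * e2pi (C * \<tau>2\<^sup>2 / 2)) (\<lambda>s. G s1 s)" for s1
  proof -
    have e1: "e2pi (- (B * s1 + C * s)) * e2pi (Q s1 (s + 1)) = e2pi (C / 2) * e2pi (Q s1 s)" for s
      unfolding e2pi_add[symmetric] by (rule arg_cong[of _ _ e2pi]) (simp add: Q_def field_simps power2_eq_square)
    have e2: "e2pi (- (\<tau>2 * B * s1 + (\<tau>2 * C + 1) * s)) * e2pi (Q s1 (s + \<tau>2))
        = e2pi (C * \<tau>2\<^sup>2 / 2) * e2pi (- s) * e2pi (Q s1 s)" for s
      unfolding e2pi_add[symmetric] by (rule arg_cong[of _ _ e2pi]) (simp add: Q_def field_simps power2_eq_square)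
    show ?thesis
      unfolding quasi_periodic_def
    proof (intro conjI allI)
      show "(\<lambda>s. G s1 s) holomorphic_on UNIV"
        unfolding G_def Q_def by (intro holomorphic_intros hol2) auto
      show "G s1 (s + 1) = k2 * e2pi (C / 2) * G s1 s" for s
        unfolding G_def p2 using e1[of s] by (simp add: mult_ac)
      show "G s1 (s + \<tau>2) = k4 * e2pi (C * \<tau>2\<^sup>2 / 2) * e2pi (- (of_nat 1 * s)) * G s1 s" for s
        unfolding G_def q2 using e2[of s] by (simp add: mult_ac)
    qed
  qed
  \<comment> \<open>Freezing one variable at a point with nonzero value gives the two factors; their
    product is \<open>c\<close> times \<open>G\<close>.\<close>
  define g1 where "g1 s = G s \<beta>" for s
  define g2 where "g2 s = G \<alpha> s" for s
  define c where "c = G \<alpha> \<beta>"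
  have c: "c \<noteq> 0" using nz by (simp add: c_def G_def)
  have split: "G s1 s2 * c = g1 s1 * g2 s2" for s1 s2
    using quasi_periodic_1_proportional[OF qp1[of s2] qp1[of \<beta>], of s1 \<alpha>] k
    by (simp add: c_def g1_def g2_def mult_ac)
  have Godd: "G (- s1) (- s2) = - G s1 s2" for s1 s2
    by (simp add: G_def odd Q_def)
  have g12: "g1 (- s1) * g2 (- s2) = - (g1 s1 * g2 s2)" for s1 s2
    unfolding split[symmetric] Godd by simp
  have c': "g1 \<alpha> = c" "g2 \<beta> = c" by (simp_all add: g1_def g2_def c_def)
  \<comment> \<open>Freezing one variable in the oddness of the product yields a parity relation for
    each factor alone.\<close>
  have par1: "g1 (- s) * g2 (- \<beta>) = - c * g1 s" and par2: "g1 (- \<alpha>) * g2 (- s) = - c * g2 s" for s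
    using g12[of s \<beta>] g12[of \<alpha> s] c' by (simp_all add: mult_ac)
  have qg: "quasi_periodic \<tau>1 1 (k1 * e2pi (A / 2)) (k3 * e2pi (A * \<tau>1\<^sup>2 / 2)) g1"
    "quasi_periodic \<tau>2 1 (k2 * e2pi (C / 2)) (k4 * e2pi (C * \<tau>2\<^sup>2 / 2)) g2"
    unfolding g1_def g2_def by (rule qp1 qp2)+
  hence hol: "g1 holomorphic_on UNIV" "g2 holomorphic_on UNIV" by (simp_all add: quasi_periodic_def)
  have d: "(g1 has_field_derivative deriv g1 s) (at s)" "(g2 has_field_derivative deriv g2 s) (at s)" for s
    using hol by (auto intro: holomorphic_derivI)
  have d0: "- deriv g 0 * u = v * deriv g 0"
    if "\<And>s. g (- s) * u = v * g s" "(g has_field_derivative deriv g 0) (at 0)" for g u v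
  proof (rule DERIV_unique)
    have g: "(g has_field_derivative deriv g 0) (at (- 0))" using that(2) by simp
    show "((\<lambda>s. g (- s) * u) has_field_derivative - deriv g 0 * u) (at 0)"
      using DERIV_cmult_right[OF DERIV_chain2[OF g DERIV_minus[OF DERIV_ident]], of u] by simp
    show "((\<lambda>s. g (- s) * u) has_field_derivative v * deriv g 0) (at 0)"
      unfolding that(1) by (rule DERIV_cmult[OF that(2)])
  qed
  have r: "g1 0 * g2 (- \<beta>) = - c * g1 0" "g1 (- \<alpha>) * g2 0 = - c * g2 0"
      "deriv g1 0 * g2 (- \<beta>) = c * deriv g1 0" "deriv g2 0 * g1 (- \<alpha>) = c * deriv g2 0"
      "g1 (- \<alpha>) * g2 (- \<beta>) = - c * c"
    using par1[of 0] par2[of 0] d0[of g1 "g2 (- \<beta>)" "- c", OF par1 d(1)]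
      d0[of g2 "g1 (- \<alpha>)" "- c", OF _ d(2)] par2 par1[of \<alpha>] c' by (simp_all add: mult_ac)
  have nd: "g1 0 \<noteq> 0 \<or> deriv g1 0 \<noteq> 0" "g2 0 \<noteq> 0 \<or> deriv g2 0 \<noteq> 0"
    using quasi_periodic_1_no_double_zero[OF qg(1), of \<alpha>] quasi_periodic_1_no_double_zero[OF qg(2), of \<beta>] k c c'
    by auto
  \<comment> \<open>If \<open>g1 0 = 0\<close>, then \<open>deriv g1 0\<close> is nonzero, which
    fixes the sign in \<open>par1\<close>: \<open>g1\<close> is odd and \<open>g2\<close> even. So
    \<open>deriv g2 0 = 0\<close>, \<open>g2 0\<close> is nonzero, and only the first summand
    survives. The other case is symmetric.\<close>
  have prod: "g1 0 * g2 0 = 0 \<and> x1 * deriv g1 0 * g2 0 + x2 * g1 0 * deriv g2 0 \<noteq> 0"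
  proof (cases "g1 0 = 0")
    case True
    hence n: "deriv g1 0 \<noteq> 0" using nd by simp
    hence "g2 (- \<beta>) = c" using r by simp
    hence "g1 (- \<alpha>) * c = (- c) * c" using r by simp
    hence "g1 (- \<alpha>) = - c" using c by (metis mult_right_cancel)
    hence "deriv g2 0 = 0" using r(4) c by auto
    with True n nd x show ?thesis by simp
  next
    case False
    have "g1 0 * g2 (- \<beta>) = g1 0 * (- c)" using r(1) by simp
    hence b: "g2 (- \<beta>) = - c" using False by (metis mult_left_cancel)
    hence d1: "deriv g1 0 = 0" using r c by simp
    from b have "g1 (- \<alpha>) = c" using r c by simp
    hence "g2 0 = 0" using r c by simp
    with False d1 nd x show ?thesis by simp
  qed
  \<comment> \<open>The exponential of \<open>- Q\<close> has value 1 and derivative 0 at the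
    origin.\<close>
  have "((\<lambda>t. g1 (x1 * t) * g2 (x2 * t) / c * e2pi (- Q (x1 * t) (x2 * t))) has_field_derivative
      (x1 * deriv g1 0 * g2 0 + x2 * g1 0 * deriv g2 0) / c) (at 0)"
  proof -
    have g1: "(g1 has_field_derivative deriv g1 0) (at (x1 * 0))"
      and g2: "(g2 has_field_derivative deriv g2 0) (at (x2 * 0))" using d[of 0] by simp_all
    have "((\<lambda>t. g1 (x1 * t)) has_field_derivative x1 * deriv g1 0) (at 0)"
      "((\<lambda>t. g2 (x2 * t)) has_field_derivative x2 * deriv g2 0) (at 0)"
      using DERIV_chain2[OF g1 DERIV_cmult_Id] DERIV_chain2[OF g2 DERIV_cmult_Id] by (simp_all add: mult.commute)
    thus ?thesis
      using c unfolding Q_def by (auto intro!: derivative_eq_intros simp: field_simps)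
  qed
  moreover have "g1 (x1 * t) * g2 (x2 * t) / c * e2pi (- Q (x1 * t) (x2 * t)) = H (x1 * t) (x2 * t)" for t
    unfolding split[symmetric] using c by (simp add: G_def e2pi_minus)
  ultimately have "D = (x1 * deriv g1 0 * g2 0 + x2 * g1 0 * deriv g2 0) / c"
    using DERIV_unique[OF D] by simp
  thus ?thesis using prod c by simp
qed

section \<open>Theta series\<close>

lemma summable_on_exp_neg_abs_int: "(\<lambda>n::int. exp (- \<bar>real_of_int n\<bar>)) summable_on UNIV"
proof -
  have geo: "(\<lambda>n::nat. exp (- real n)) summable_on UNIV"
  proof (rule norm_summable_imp_summable_on)
    have "exp (- real n) = exp (- 1) ^ n" for n
      by (simp flip: exp_of_nat_mult)
    thus "summable (\<lambda>n. norm (exp (- real n)))"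
      by (simp add: summable_geometric)
  qed
  have *: "(\<lambda>n::int. exp (- \<bar>real_of_int n\<bar>)) summable_on range int"
    by (subst summable_on_reindex) (use geo in \<open>auto simp: o_def inj_on_def\<close>)
  have **: "(\<lambda>n::int. exp (- \<bar>real_of_int n\<bar>)) summable_on range (\<lambda>n. - int n)"
    by (subst summable_on_reindex) (use geo in \<open>auto simp: o_def inj_on_def\<close>)
  have "UNIV = range int \<union> range (\<lambda>n. - int n)"
    by (auto simp: image_iff) (metis int_cases2)
  with summable_on_union[OF * **] show ?thesis by simp
qed

lemma summable_on_exp_neg_abs_int2:
  "(\<lambda>x::int \<times> int. exp (- \<bar>real_of_int (fst x)\<bar> - \<bar>real_of_int (snd x)\<bar>)) summable_on UNIV"
proof -
  let ?e = "\<lambda>n::int. exp (- \<bar>real_of_int n\<bar>)"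
  have "(\<lambda>(a, b). ?e a * ?e b) summable_on UNIV \<times> UNIV"
  proof (rule summable_on_SigmaI[OF _ summable_on_cmult_left[OF summable_on_exp_neg_abs_int]])
    show "((\<lambda>b. (\<lambda>(a, b). ?e a * ?e b) (a, b)) has_sum ?e a * infsum ?e UNIV) UNIV" for a
      unfolding prod.case by (intro has_sum_cmult_right has_sum_infsum summable_on_exp_neg_abs_int)
  qed auto
  thus ?thesis by (simp add: case_prod_unfold exp_add[symmetric])
qed

text \<open>On the closed unit disc about \<open>t\<close> one has |u| \<le> |t| + 1, so the
  hypothesis with R = |t| + 1 supplies a Weierstrass majorant. The theorem on uniform limits of
  holomorphic functions yields the convergence of the differentiated series as well.\<close>

lemma exp_sum_has_field_derivative:
  fixes c B :: "'a \<Rightarrow> complex"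
  assumes summable: "\<And>R. (\<lambda>x. norm (c x) * exp (R * norm (B x))) summable_on UNIV"
  shows "((\<lambda>t. \<Sum>\<^sub>\<infinity>x. c x * exp (t * B x)) has_field_derivative (\<Sum>\<^sub>\<infinity>x. c x * B x * exp (t * B x))) (at t)"
proof -
  let ?F = "finite_subsets_at_top (UNIV :: 'a set)"
  have ulim: "uniform_limit (cball t 1) (\<lambda>X u. \<Sum>x\<in>X. c x * exp (u * B x)) (\<lambda>u. \<Sum>\<^sub>\<infinity>x. c x * exp (u * B x)) ?F"
  proof (rule Weierstrass_m_test_general[OF _ summable[of "norm t + 1"]])
    fix x u assume "u \<in> cball t 1"
    hence "norm u \<le> norm t + 1" using norm_triangle_sub[of u t] by (simp add: dist_norm norm_minus_commute)
    hence "Re (u * B x) \<le> (norm t + 1) * norm (B x)"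
      using complex_Re_le_cmod[of "u * B x"] mult_right_mono[of "norm u" "norm t + 1" "norm (B x)"]
      by (simp add: norm_mult)
    thus "norm (c x * exp (u * B x)) \<le> norm (c x) * exp ((norm t + 1) * norm (B x))"
      by (simp add: norm_mult mult_left_mono)
  qed
  have der: "((\<lambda>u. \<Sum>x\<in>X. c x * exp (u * B x)) has_field_derivative (\<Sum>x\<in>X. c x * B x * exp (w * B x))) (at w)" for X w
    by (auto intro!: derivative_eq_intros sum.cong simp: mult_ac)
  have cont: "continuous_on (cball t 1) (\<lambda>u. \<Sum>x\<in>X. c x * exp (u * B x))" for X
    by (intro continuous_intros)
  obtain g' where "\<And>w. w \<in> ball t 1 \<Longrightarrow> ((\<lambda>u. \<Sum>\<^sub>\<infinity>x. c x * exp (u * B x)) has_field_derivative g' w) (at w)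
      \<and> ((\<lambda>X. \<Sum>x\<in>X. c x * B x * exp (w * B x)) \<longlongrightarrow> g' w) ?F"
    by (rule has_complex_derivative_uniform_limit[of t 1 "\<lambda>X u. \<Sum>x\<in>X. c x * exp (u * B x)"
          "\<lambda>X w. \<Sum>x\<in>X. c x * B x * exp (w * B x)" ?F, OF _ ulim]) (use der cont in auto)
  from this[of t] have d: "((\<lambda>u. \<Sum>\<^sub>\<infinity>x. c x * exp (u * B x)) has_field_derivative g' t) (at t)"
    and l: "((\<lambda>x. c x * B x * exp (t * B x)) has_sum g' t) UNIV"
    by (simp_all add: has_sum_def)
  from infsumI[OF l] d show ?thesis by simp
qed

section \<open>Uniqueness of double Fourier series\<close>

lemma sum_e2pi_root:
  assumes "N > 0"
  shows "(\<Sum>i<N. e2pi (of_int n * of_nat i / of_nat N)) = (if int N dvd n then of_nat N else 0)"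
proof -
  define w where "w = e2pi (of_int n / of_nat N)"
  have p: "e2pi (of_int n * of_nat i / of_nat N) = w ^ i" for i
    by (simp add: w_def e2pi_power mult_ac)
  have "w = 1 \<longleftrightarrow> (of_int n / of_nat N :: complex) \<in> \<int>"
    by (simp add: w_def e2pi_eq_1_iff)
  also have "\<dots> \<longleftrightarrow> int N dvd n"
  proof
    assume "(of_int n / of_nat N :: complex) \<in> \<int>"
    then obtain k where "(of_int n / of_nat N :: complex) = of_int k" by (auto elim: Ints_cases)
    hence "(of_int n :: complex) = of_int (int N * k)" using assms by (simp add: field_simps)
    thus "int N dvd n" by (simp only: of_int_eq_iff) simp
  next
    assume "int N dvd n"
    then obtain k where "n = int N * k" by blast
    thus "(of_int n / of_nat N :: complex) \<in> \<int>" using assms by simp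
  qed
  finally have w: "w = 1 \<longleftrightarrow> int N dvd n" .
  have "w ^ N = 1" using assms by (simp add: w_def e2pi_power)
  thus ?thesis unfolding p using w by (auto simp: geometric_sum)
qed

lemma has_sum_finite_sum:
  fixes f :: "'b \<Rightarrow> 'a \<Rightarrow> 'c :: topological_ab_group_add"
  assumes "finite P" "\<And>p. p \<in> P \<Longrightarrow> (f p has_sum s p) A"
  shows "((\<lambda>x. \<Sum>p\<in>P. f p x) has_sum (\<Sum>p\<in>P. s p)) A"
  using assms by (induction P rule: finite_induct) (auto intro: has_sum_add)

text \<open>The coefficient at \<open>k\<close> is isolated by averaging over the points \<open>(i/N, j/N)\<close>: this leaves
  the coefficients congruent to \<open>k\<close> modulo \<open>N\<close>, and all but \<open>k\<close> among them are far out.\<close>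

lemma double_fourier_series_eq_0:
  fixes c :: "int \<times> int \<Rightarrow> complex"
  assumes c: "(\<lambda>x. norm (c x)) summable_on UNIV"
    and zero: "\<And>\<theta>1 \<theta>2 :: real. (\<Sum>\<^sub>\<infinity>x. c x * e2pi (of_real (of_int (fst x) * \<theta>1 + of_int (snd x) * \<theta>2))) = 0"
  shows "c k = 0"
proof (rule ccontr)
  assume ck: "c k \<noteq> 0"
  define e where "e = (\<lambda>x :: int \<times> int. \<lambda>\<theta>1 \<theta>2 :: real. e2pi (of_real (of_int (fst x) * \<theta>1 + of_int (snd x) * \<theta>2)))"
  have ne: "norm (e x \<theta>1 \<theta>2) = 1" for x \<theta>1 \<theta>2 by (simp add: e_def norm_e2pi)
  have sm: "(\<lambda>x. c x * u x) summable_on S" if "\<And>x. norm (u x) \<le> 1" for u S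
  proof (rule abs_summable_summable, rule Infinite_Sum.abs_summable_on_comparison_test')
    show "(\<lambda>x. norm (c x)) summable_on S" using c summable_on_subset_banach by blast
    show "norm (c x * u x) \<le> norm (c x)" for x
      using mult_left_mono[OF that[of x], of "norm (c x)"] by (simp add: norm_mult)
  qed
  have "((\<lambda>x. norm (c x)) has_sum (\<Sum>\<^sub>\<infinity>x. norm (c x))) UNIV" using c by simp
  hence "((sum (\<lambda>x. norm (c x))) \<longlongrightarrow> (\<Sum>\<^sub>\<infinity>x. norm (c x))) (finite_subsets_at_top UNIV)"
    by (simp add: has_sum_def)
  hence "eventually (\<lambda>F. dist (\<Sum>x\<in>F. norm (c x)) (\<Sum>\<^sub>\<infinity>x. norm (c x)) < norm (c k)) (finite_subsets_at_top UNIV)"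
    using ck by (intro tendstoD) auto
  then obtain F0 where F0: "finite F0" and
    *: "\<And>F. finite F \<Longrightarrow> F0 \<subseteq> F \<Longrightarrow> dist (\<Sum>x\<in>F. norm (c x)) (\<Sum>\<^sub>\<infinity>x. norm (c x)) < norm (c k)"
    unfolding eventually_finite_subsets_at_top by auto
  define F where "F = insert k F0"
  have F: "finite F" "k \<in> F" using F0 by (simp_all add: F_def)
  have tail: "(\<Sum>\<^sub>\<infinity>x\<in>-F. norm (c x)) < norm (c k)"
  proof -
    have "(\<Sum>\<^sub>\<infinity>x\<in>UNIV - F. norm (c x)) = (\<Sum>\<^sub>\<infinity>x. norm (c x)) - (\<Sum>\<^sub>\<infinity>x\<in>F. norm (c x))"
      by (rule infsum_Diff) (use c summable_on_subset_banach in auto)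
    with *[of F] F subset_insertI[of F0 k] show ?thesis by (simp add: F_def Compl_eq_Diff_UNIV dist_real_def abs_less_iff)
  qed
  \<comment> \<open>\<open>N\<close> exceeds the distance in each coordinate from \<open>k\<close>
    to any point of \<open>F\<close>, so \<open>k\<close> is the only point of \<open>F\<close>
    congruent to \<open>k\<close> modulo \<open>N\<close>.\<close>
  define N where "N = Suc (\<Sum>x\<in>F. nat \<bar>fst x - fst k\<bar> + nat \<bar>snd x - snd k\<bar>)"
  have Npos: "N > 0" by (simp add: N_def)
  have small: "nat \<bar>fst x - fst k\<bar> + nat \<bar>snd x - snd k\<bar> < N" if "x \<in> F" for x
    unfolding N_def using member_le_sum[OF that, of "\<lambda>x. nat \<bar>fst x - fst k\<bar> + nat \<bar>snd x - snd k\<bar>"] F by simp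
  define \<delta> where "\<delta> x = (if int N dvd fst x - fst k \<and> int N dvd snd x - snd k then 1 else 0 :: complex)" for x
  have dF: "\<delta> x = 0" if "x \<in> F" "x \<noteq> k" for x
  proof -
    have "x = k" if "int N dvd fst x - fst k" "int N dvd snd x - snd k"
    proof -
      have "\<bar>fst x - fst k\<bar> < int N" "\<bar>snd x - snd k\<bar> < int N" using small[OF \<open>x \<in> F\<close>] by auto
      with that have "fst x - fst k = 0" "snd x - snd k = 0"
        using dvd_imp_le_int[of "fst x - fst k" "int N"] dvd_imp_le_int[of "snd x - snd k" "int N"] by force+
      thus ?thesis by (simp add: prod_eq_iff)
    qed
    with that show ?thesis by (auto simp: \<delta>_def)
  qed
  have avg: "(\<Sum>p\<in>{..<N}\<times>{..<N}. e (fst x - fst k, snd x - snd k) (real (fst p) / N) (real (snd p) / N)) = of_nat (N * N) * \<delta> x" for x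
  proof -
    have "(\<Sum>p\<in>{..<N}\<times>{..<N}. e (fst x - fst k, snd x - snd k) (real (fst p) / N) (real (snd p) / N))
      = (\<Sum>i<N. \<Sum>j<N. e2pi (of_int (fst x - fst k) * of_nat i / of_nat N) * e2pi (of_int (snd x - snd k) * of_nat j / of_nat N))"
      by (simp add: sum.cartesian_product case_prod_unfold e_def flip: e2pi_add)
    also have "\<dots> = (\<Sum>i<N. e2pi (of_int (fst x - fst k) * of_nat i / of_nat N)) * (\<Sum>j<N. e2pi (of_int (snd x - snd k) * of_nat j / of_nat N))"
      by (simp add: sum_product)
    also have "\<dots> = of_nat (N * N) * \<delta> x"
      by (subst (1 2) sum_e2pi_root) (simp_all add: Npos \<delta>_def)
    finally show ?thesis .
  qed
  have "(\<Sum>\<^sub>\<infinity>x. c x * \<delta> x) = 0"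
  proof -
    have z: "((\<lambda>x. c x * e (fst x - fst k, snd x - snd k) \<theta>1 \<theta>2) has_sum 0) UNIV" for \<theta>1 \<theta>2
    proof -
      have "((\<lambda>x. c x * e x \<theta>1 \<theta>2) has_sum (\<Sum>\<^sub>\<infinity>x. c x * e x \<theta>1 \<theta>2)) UNIV"
        using sm[of "\<lambda>x. e x \<theta>1 \<theta>2" UNIV] ne by simp
      hence "((\<lambda>x. c x * e x \<theta>1 \<theta>2) has_sum 0) UNIV"
        using zero[of \<theta>1 \<theta>2] by (simp add: e_def)
      from has_sum_cmult_left[OF this, of "e (- fst k, - snd k) \<theta>1 \<theta>2"]
      show ?thesis by (simp add: e_def algebra_simps flip: e2pi_add)
    qed
    have "((\<lambda>x. \<Sum>p\<in>{..<N}\<times>{..<N}. c x * e (fst x - fst k, snd x - snd k) (real (fst p) / N) (real (snd p) / N))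
        has_sum (\<Sum>p\<in>{..<N}\<times>{..<N}. 0)) UNIV"
      by (intro has_sum_finite_sum z) simp
    hence "((\<lambda>x. of_nat (N * N) * (c x * \<delta> x)) has_sum 0) UNIV"
      by (simp add: avg mult_ac flip: sum_distrib_left)
    hence "((\<lambda>x. inverse (of_nat (N * N)) * (of_nat (N * N) * (c x * \<delta> x))) has_sum inverse (of_nat (N * N)) * 0) UNIV"
      by (rule has_sum_cmult_right)
    moreover have "inverse (of_nat (N * N)) * (of_nat (N * N) * y) = y" for y :: complex
      using Npos by (simp add: field_simps)
    ultimately have "((\<lambda>x. c x * \<delta> x) has_sum 0) UNIV" by (simp only: mult_zero_right)
    thus ?thesis by (rule infsumI)
  qed
  moreover have "(\<Sum>\<^sub>\<infinity>x. c x * \<delta> x) = (\<Sum>\<^sub>\<infinity>x\<in>F. c x * \<delta> x) + (\<Sum>\<^sub>\<infinity>x\<in>-F. c x * \<delta> x)"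
    using infsum_Un_disjoint[of "\<lambda>x. c x * \<delta> x" F "-F"] sm[of \<delta>] by (simp add: \<delta>_def)
  moreover have "(\<Sum>\<^sub>\<infinity>x\<in>F. c x * \<delta> x) = c k"
  proof -
    have "(\<Sum>x\<in>F. c x * \<delta> x) = (\<Sum>x\<in>F. if x = k then c k else 0)"
      by (rule sum.cong) (use dF in \<open>auto simp: \<delta>_def\<close>)
    thus ?thesis using F by simp
  qed
  moreover have "norm (\<Sum>\<^sub>\<infinity>x\<in>-F. c x * \<delta> x) \<le> (\<Sum>\<^sub>\<infinity>x\<in>-F. norm (c x))"
  proof (rule norm_infsum_le)
    show "((\<lambda>x. c x * \<delta> x) has_sum (\<Sum>\<^sub>\<infinity>x\<in>-F. c x * \<delta> x)) (-F)"
      using sm[of \<delta> "-F"] by (simp add: \<delta>_def)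
    show "((\<lambda>x. norm (c x)) has_sum (\<Sum>\<^sub>\<infinity>x\<in>-F. norm (c x))) (-F)"
      using c summable_on_subset_banach by (metis has_sum_infsum subset_UNIV)
  qed (simp add: \<delta>_def norm_mult)
  ultimately have "norm (c k) \<le> (\<Sum>\<^sub>\<infinity>x\<in>-F. norm (c x))"
    by (metis add.commute add_eq_0_iff norm_minus_cancel)
  with tail show False by simp
qed

section \<open>Odd theta functions in two variables\<close>

text \<open>In the application \<gamma> and \<gamma>' are \<open>gamma0 D\<close> and its conjugate,
  (m1, m2) is the first half of the characteristic, M = 2 m, and \<epsilon> is the sign character
  given by the second half. \<open>eps_odd\<close> encodes that the characteristic is odd.\<close>

locale quad_theta =
  fixes \<gamma> \<gamma>' :: real and m1 m2 :: real and M :: "int \<times> int" and \<epsilon> :: "int \<times> int \<Rightarrow> complex"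
    and z1 z2 :: complex
  assumes gamma: "\<gamma> \<noteq> \<gamma>'" and im: "Im z1 > 0" "Im z2 > 0"
    and M: "2 * m1 = of_int (fst M)" "2 * m2 = of_int (snd M)"
    and eps: "\<epsilon> x = 1 \<or> \<epsilon> x = - 1" and eps_add: "\<epsilon> (x + y) = \<epsilon> x * \<epsilon> y"
    and eps_odd: "\<epsilon> M = - 1"
begin

definition r :: "int \<times> int \<Rightarrow> real" where
  "r x = (of_int (fst x) + m1) + (of_int (snd x) + m2) * \<gamma>"

definition r' :: "int \<times> int \<Rightarrow> real" where
  "r' x = (of_int (fst x) + m1) + (of_int (snd x) + m2) * \<gamma>'"

text \<open>The variables \<open>v1\<close>, \<open>v2\<close> do not occur in
  \<open>D2_theta\<close>; differentiating in \<open>v2\<close> at 0 brings down its factor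
  \<open>r' x\<close>.\<close>

definition summand :: "int \<times> int \<Rightarrow> complex \<Rightarrow> complex \<Rightarrow> complex" where
  "summand x v1 v2 = \<epsilon> x * e2pi (1/2 * of_real ((r x)\<^sup>2) * z1 + 1/2 * of_real ((r' x)\<^sup>2) * z2
     + of_real (r x) * v1 + of_real (r' x) * v2)"

definition \<Theta> :: "complex \<Rightarrow> complex \<Rightarrow> complex" where
  "\<Theta> v1 v2 = (\<Sum>\<^sub>\<infinity>x. summand x v1 v2)"

lemma norm_eps [simp]: "norm (\<epsilon> x) = 1"
  using eps[of x] by auto

lemma norm_summand:
  "norm (summand x v1 v2) = exp (- pi * ((r x)\<^sup>2 * Im z1 + (r' x)\<^sup>2 * Im z2)
     - 2 * pi * (r x * Im v1 + r' x * Im v2))"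
  by (simp add: summand_def norm_mult norm_e2pi algebra_simps)

text \<open>Since \<gamma> \<noteq> \<gamma>', the index is bounded linearly by |r x| + |r' x|. The
  Gaussian absorbs every linear term, hence also the one that leaves exp (- |x1| - |x2|) as
  majorant.\<close>

lemma summable_gaussian:
  "(\<lambda>x. exp (- pi * ((r x)\<^sup>2 * Im z1 + (r' x)\<^sup>2 * Im z2) + R * (\<bar>r x\<bar> + \<bar>r' x\<bar>))) summable_on UNIV"
proof -
  define g where "g = 1 / \<bar>\<gamma> - \<gamma>'\<bar>"
  define C where "C = 1 + (1 + \<bar>\<gamma>\<bar>) * g"
  \<comment> \<open>Completing the square bounds - a t^2 + (R + C) |t| by (R + C)^2 / (4 a); this is
    used for both a = pi Im z1 and a = pi Im z2.\<close>
  define K where "K = \<bar>m1\<bar> + \<bar>m2\<bar> + (R + C)\<^sup>2 / (4 * (pi * Im z1)) + (R + C)\<^sup>2 / (4 * (pi * Im z2))"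
  have bound: "- pi * ((r x)\<^sup>2 * Im z1 + (r' x)\<^sup>2 * Im z2) + R * (\<bar>r x\<bar> + \<bar>r' x\<bar>)
      \<le> K + (- \<bar>real_of_int (fst x)\<bar> - \<bar>real_of_int (snd x)\<bar>)" for x
  proof -
    define S where "S = \<bar>r x\<bar> + \<bar>r' x\<bar>"
    have "(of_int (snd x) + m2) * (\<gamma> - \<gamma>') = r x - r' x" by (simp add: r_def r'_def algebra_simps)
    hence "\<bar>of_int (snd x) + m2\<bar> = \<bar>r x - r' x\<bar> * g"
      using gamma by (simp add: g_def field_simps flip: abs_mult)
    also have "\<dots> \<le> S * g" unfolding S_def by (intro mult_right_mono) (auto simp: g_def)
    finally have 2: "\<bar>of_int (snd x) + m2\<bar> \<le> S * g" .
    have "\<bar>of_int (fst x) + m1\<bar> = \<bar>r x - (of_int (snd x) + m2) * \<gamma>\<bar>" by (simp add: r_def)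
    also have "\<dots> \<le> \<bar>r x\<bar> + \<bar>of_int (snd x) + m2\<bar> * \<bar>\<gamma>\<bar>" by (metis abs_triangle_ineq4 abs_mult)
    also have "\<dots> \<le> S + S * g * \<bar>\<gamma>\<bar>"
      by (rule add_mono[OF _ mult_right_mono[OF 2]]) (simp_all add: S_def)
    finally have "\<bar>of_int (fst x)\<bar> + \<bar>of_int (snd x)\<bar> \<le> \<bar>m1\<bar> + \<bar>m2\<bar> + C * S"
      using 2 by (simp add: C_def algebra_simps)
    moreover have "- a * t\<^sup>2 + (R + C) * \<bar>t\<bar> \<le> (R + C)\<^sup>2 / (4 * a)" if "a > 0" for a t :: real
    proof -
      have "0 \<le> (2 * a * \<bar>t\<bar> - (R + C))\<^sup>2" by simp
      hence "4 * a * (- a * t\<^sup>2 + (R + C) * \<bar>t\<bar>) \<le> (R + C)\<^sup>2"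
        by (simp add: power2_diff power_mult_distrib algebra_simps power2_eq_square)
      thus ?thesis using that by (simp add: field_simps)
    qed
    from this[of "pi * Im z1" "r x"] this[of "pi * Im z2" "r' x"]
    have "- (pi * Im z1) * (r x)\<^sup>2 + (R + C) * \<bar>r x\<bar> + (- (pi * Im z2) * (r' x)\<^sup>2 + (R + C) * \<bar>r' x\<bar>)
       \<le> (R + C)\<^sup>2 / (4 * (pi * Im z1)) + (R + C)\<^sup>2 / (4 * (pi * Im z2))"
      using im by (intro add_mono) auto
    ultimately show ?thesis by (simp add: K_def S_def algebra_simps)
  qed
  show ?thesis
  proof (rule summable_on_comparison_test)
    show "(\<lambda>x::int\<times>int. exp K * exp (- \<bar>real_of_int (fst x)\<bar> - \<bar>real_of_int (snd x)\<bar>)) summable_on UNIV"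
      by (intro summable_on_cmult_right summable_on_exp_neg_abs_int2)
    show "exp (- pi * ((r x)\<^sup>2 * Im z1 + (r' x)\<^sup>2 * Im z2) + R * (\<bar>r x\<bar> + \<bar>r' x\<bar>))
        \<le> exp K * exp (- \<bar>real_of_int (fst x)\<bar> - \<bar>real_of_int (snd x)\<bar>)" for x
      using bound[of x] by (simp flip: exp_add)
  qed auto
qed

text \<open>The majorant hypothesis of \<open>exp_sum_has_field_derivative\<close> on the line
  through (w1, w2) in direction (u1, u2).\<close>

lemma summable_summand_line:
  "(\<lambda>x. norm (summand x w1 w2) * exp (R * norm (2 * of_real pi * \<i> * (of_real (r x) * u1 + of_real (r' x) * u2)))) summable_on UNIV"
proof (rule summable_on_comparison_test)
  define B where "B = 2 * pi * (norm w1 + norm w2) + \<bar>R\<bar> * (2 * pi) * (norm u1 + norm u2)"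
  show "(\<lambda>x. exp (- pi * ((r x)\<^sup>2 * Im z1 + (r' x)\<^sup>2 * Im z2) + B * (\<bar>r x\<bar> + \<bar>r' x\<bar>))) summable_on UNIV"
    by (rule summable_gaussian)
  fix x
  have lin: "\<bar>r x\<bar> * a + \<bar>r' x\<bar> * b \<le> (\<bar>r x\<bar> + \<bar>r' x\<bar>) * (a + b)" if "a \<ge> 0" "b \<ge> 0" for a b
    using that by (simp add: algebra_simps)
  have "\<bar>r x * Im w1 + r' x * Im w2\<bar> \<le> \<bar>r x\<bar> * norm w1 + \<bar>r' x\<bar> * norm w2"
    using abs_Im_le_cmod[of w1] abs_Im_le_cmod[of w2]
    by (intro order_trans[OF abs_triangle_ineq] add_mono) (auto simp: abs_mult intro!: mult_left_mono)
  also note lin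
  finally have "- (r x * Im w1 + r' x * Im w2) \<le> (\<bar>r x\<bar> + \<bar>r' x\<bar>) * (norm w1 + norm w2)"
    unfolding abs_le_iff by simp
  hence 1: "2 * pi * - (r x * Im w1 + r' x * Im w2) \<le> 2 * pi * ((\<bar>r x\<bar> + \<bar>r' x\<bar>) * (norm w1 + norm w2))"
    by (rule mult_left_mono) simp
  have "norm (of_real (r x) * u1 + of_real (r' x) * u2) \<le> \<bar>r x\<bar> * norm u1 + \<bar>r' x\<bar> * norm u2"
    by (intro order_trans[OF norm_triangle_ineq]) (simp add: norm_mult)
  also note lin
  finally have "norm (2 * of_real pi * \<i> * (of_real (r x) * u1 + of_real (r' x) * u2))
      \<le> 2 * pi * ((\<bar>r x\<bar> + \<bar>r' x\<bar>) * (norm u1 + norm u2))"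
    by (simp add: norm_mult)
  hence "R * norm (2 * of_real pi * \<i> * (of_real (r x) * u1 + of_real (r' x) * u2))
      \<le> \<bar>R\<bar> * (2 * pi * ((\<bar>r x\<bar> + \<bar>r' x\<bar>) * (norm u1 + norm u2)))"
    by (intro mult_mono) auto
  with 1 show "norm (summand x w1 w2) * exp (R * norm (2 * of_real pi * \<i> * (of_real (r x) * u1 + of_real (r' x) * u2)))
    \<le> exp (- pi * ((r x)\<^sup>2 * Im z1 + (r' x)\<^sup>2 * Im z2) + B * (\<bar>r x\<bar> + \<bar>r' x\<bar>))"
    unfolding norm_summand exp_add[symmetric] by (simp add: B_def algebra_simps)
qed auto

lemma summand_line:
  "summand x (t * u1 + w1) (t * u2 + w2) =
     summand x w1 w2 * exp (t * (2 * of_real pi * \<i> * (of_real (r x) * u1 + of_real (r' x) * u2)))"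
  unfolding summand_def e2pi_def mult.assoc exp_add[symmetric]
  by (rule arg_cong[of _ _ "\<lambda>s. \<epsilon> x * exp s"]) (simp add: algebra_simps)

lemma has_field_derivative_Theta_line:
  "((\<lambda>t. \<Theta> (t * u1 + w1) (t * u2 + w2)) has_field_derivative
     (\<Sum>\<^sub>\<infinity>x. summand x w1 w2 * (2 * of_real pi * \<i> * (of_real (r x) * u1 + of_real (r' x) * u2)) *
        exp (t * (2 * of_real pi * \<i> * (of_real (r x) * u1 + of_real (r' x) * u2))))) (at t)"
  unfolding \<Theta>_def summand_line
  by (rule exp_sum_has_field_derivative, rule summable_summand_line)

lemma holomorphic_Theta_line: "(\<lambda>t. \<Theta> (t * u1 + w1) (t * u2 + w2)) holomorphic_on UNIV"
  unfolding holomorphic_on_def field_differentiable_def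
  using has_field_derivative_at_within has_field_derivative_Theta_line by blast

text \<open>Apart from 2 pi i and a power of i, the right-hand side is the series of
  \<open>D2_theta\<close>.\<close>

lemma has_field_derivative_Theta_2:
  "((\<lambda>t. \<Theta> 0 t) has_field_derivative
     2 * of_real pi * \<i> * (\<Sum>\<^sub>\<infinity>x. \<epsilon> x * of_real (r' x) *
       e2pi (1/2 * of_real ((r x)\<^sup>2) * z1 + 1/2 * of_real ((r' x)\<^sup>2) * z2))) (at 0)"
proof -
  have "(\<Sum>\<^sub>\<infinity>x. summand x 0 0 * (2 * of_real pi * \<i> * of_real (r' x))) =
     2 * of_real pi * \<i> * (\<Sum>\<^sub>\<infinity>x. \<epsilon> x * of_real (r' x) *
       e2pi (1/2 * of_real ((r x)\<^sup>2) * z1 + 1/2 * of_real ((r' x)\<^sup>2) * z2))"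
    by (subst infsum_cmult_right'[symmetric]) (simp add: summand_def mult_ac)
  thus ?thesis using has_field_derivative_Theta_line[of 0 0 1 0 0] by simp
qed

lemma eps_minus: "\<epsilon> (- x) = \<epsilon> x"
proof -
  have "\<epsilon> 0 = 1" using eps[of 0] eps_add[of 0 0] by auto
  hence "\<epsilon> x * \<epsilon> (- x) = 1" using eps_add[of x "- x"] by simp
  thus ?thesis using eps[of x] eps[of "- x"] by auto
qed

text \<open>Reindexing by x \<mapsto> - x - M negates \<open>r\<close> and \<open>r'\<close> because
  M = 2 m, while the sign changes by \<open>\<epsilon> M = - 1\<close>.\<close>

lemma Theta_odd: "\<Theta> (- v1) (- v2) = - \<Theta> v1 v2"
proof -
  have bij: "bij_betw (\<lambda>x. - x - M) UNIV UNIV"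
    by (rule bij_betwI[of _ _ _ "\<lambda>x. - x - M"]) auto
  have r: "r (- x - M) = - r x" "r' (- x - M) = - r' x" for x
    using M by (simp_all add: r_def r'_def algebra_simps flip: M)
  have "\<epsilon> (- x - M) = - \<epsilon> x" for x
    using eps_add[of "- x" "- M"] eps_odd by (simp add: eps_minus)
  hence "summand (- x - M) (- v1) (- v2) = - summand x v1 v2" for x
    by (simp add: summand_def r)
  hence "\<Theta> (- v1) (- v2) = (\<Sum>\<^sub>\<infinity>x. - summand x v1 v2)"
    unfolding \<Theta>_def using infsum_reindex_bij_betw[OF bij, of "\<lambda>x. summand x (- v1) (- v2)"] by simp
  thus ?thesis by (simp add: infsum_uminus \<Theta>_def)
qed

text \<open>The index shift by \<open>n\<close> absorbs \<open>a * z1\<close> and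
  \<open>a' * z2\<close> by completing the square. The shift by \<open>b\<close>, \<open>b'\<close>
  adds r x b + r' x b' to the exponent; by the two integrality conditions this is a constant plus an
  integer.\<close>

lemma Theta_translate:
  assumes a: "a = of_int (fst n) + of_int (snd n) * \<gamma>" "a' = of_int (fst n) + of_int (snd n) * \<gamma>'"
    and b: "b + b' \<in> \<int>" "\<gamma> * b + \<gamma>' * b' \<in> \<int>"
  obtains k where "k \<noteq> 0" "\<And>v1 v2. \<Theta> (v1 + (of_real a * z1 + of_real b)) (v2 + (of_real a' * z2 + of_real b'))
      = k * e2pi (- (of_real a * v1 + of_real a' * v2)) * \<Theta> v1 v2"
proof -
  define k where "k = \<epsilon> n * e2pi (of_real (m1 * (b + b') + m2 * (\<gamma> * b + \<gamma>' * b'))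
    - (of_real (a\<^sup>2) * z1 + of_real (a'\<^sup>2) * z2) / 2 - of_real (a * b + a' * b'))"
  have bij: "bij_betw (\<lambda>x. x - n) UNIV UNIV"
    by (rule bij_betwI[of _ _ _ "\<lambda>x. x + n"]) auto
  have shifted: "summand (x - n) (v1 + (of_real a * z1 + of_real b)) (v2 + (of_real a' * z2 + of_real b'))
      = k * e2pi (- (of_real a * v1 + of_real a' * v2)) * summand x v1 v2" for x v1 v2
  proof -
    have r: "r (x - n) = r x - a" "r' (x - n) = r' x - a'"
      by (simp_all add: r_def r'_def a algebra_simps)
    have "\<epsilon> (x - n) = \<epsilon> n * \<epsilon> x" using eps_add[of x "- n"] by (simp add: eps_minus)
    obtain i j where ij: "b + b' = of_int i" "\<gamma> * b + \<gamma>' * b' = of_int j"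
      using b by (auto elim!: Ints_cases)
    have "r x * b + r' x * b' = (of_int (fst x) + m1) * (b + b') + (of_int (snd x) + m2) * (\<gamma> * b + \<gamma>' * b')"
      by (simp add: r_def r'_def algebra_simps)
    also have "\<dots> = of_int (fst x * i + snd x * j) + (m1 * (b + b') + m2 * (\<gamma> * b + \<gamma>' * b'))"
      by (simp add: ij algebra_simps)
    finally have rb: "of_real (r x) * of_real b + of_real (r' x) * of_real b'
        = (of_int (fst x * i + snd x * j) :: complex) + of_real (m1 * (b + b') + m2 * (\<gamma> * b + \<gamma>' * b'))"
      by (metis of_real_add of_real_mult of_real_of_int_eq)
    have "e2pi (1/2 * of_real ((r x - a)\<^sup>2) * z1 + 1/2 * of_real ((r' x - a')\<^sup>2) * z2
        + of_real (r x - a) * (v1 + (of_real a * z1 + of_real b)) + of_real (r' x - a') * (v2 + (of_real a' * z2 + of_real b')))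
      = e2pi (1/2 * of_real ((r x)\<^sup>2) * z1 + 1/2 * of_real ((r' x)\<^sup>2) * z2 + of_real (r x) * v1 + of_real (r' x) * v2
        - (of_real (a\<^sup>2) * z1 + of_real (a'\<^sup>2) * z2) / 2 - of_real (a * b + a' * b')
        - (of_real a * v1 + of_real a' * v2) + (of_real (r x) * of_real b + of_real (r' x) * of_real b'))"
      by (rule arg_cong[of _ _ e2pi]) (simp add: field_simps power2_eq_square)
    also have "\<dots> = e2pi (of_real (m1 * (b + b') + m2 * (\<gamma> * b + \<gamma>' * b'))
        - (of_real (a\<^sup>2) * z1 + of_real (a'\<^sup>2) * z2) / 2 - of_real (a * b + a' * b'))
        * e2pi (- (of_real a * v1 + of_real a' * v2))
        * e2pi (1/2 * of_real ((r x)\<^sup>2) * z1 + 1/2 * of_real ((r' x)\<^sup>2) * z2 + of_real (r x) * v1 + of_real (r' x) * v2)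
        * e2pi (of_int (fst x * i + snd x * j))"
      unfolding rb e2pi_add[symmetric] by (rule arg_cong[of _ _ e2pi]) (simp add: algebra_simps)
    finally show ?thesis
      unfolding summand_def r \<open>\<epsilon> (x - n) = _\<close> k_def by (simp only: e2pi_of_int mult_ac mult_1)
  qed
  show thesis
  proof
    show "k \<noteq> 0" using eps[of n] by (auto simp: k_def)
    show "\<Theta> (v1 + (of_real a * z1 + of_real b)) (v2 + (of_real a' * z2 + of_real b'))
      = k * e2pi (- (of_real a * v1 + of_real a' * v2)) * \<Theta> v1 v2" for v1 v2
      unfolding \<Theta>_def infsum_cmult_right'[symmetric] shifted[symmetric]
      by (rule infsum_reindex_bij_betw[OF bij, symmetric])
  qed
qed

text \<open>On real arguments \<Theta> is a double Fourier series in \<theta>1 = v1 + v2 and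
  \<theta>2 = \<gamma> v1 + \<gamma>' v2 whose coefficients \<open>summand x 0 0\<close> are
  nonzero; as \<gamma> \<noteq> \<gamma>', all real pairs (\<theta>1, \<theta>2) occur.\<close>

lemma Theta_nonzero: "\<exists>v1 v2. \<Theta> v1 v2 \<noteq> 0"
proof (rule ccontr)
  assume "\<not> ?thesis"
  hence zero: "\<Theta> v1 v2 = 0" for v1 v2 by blast
  have "summand 0 0 0 = 0"
  proof (rule double_fourier_series_eq_0)
    show "(\<lambda>x. norm (summand x 0 0)) summable_on UNIV"
      using summable_summand_line[of 0 0 0 0 0] by simp
    fix \<theta>1 \<theta>2 :: real
    define v2 where "v2 = (\<theta>2 - \<gamma> * \<theta>1) / (\<gamma>' - \<gamma>)"
    define v1 where "v1 = \<theta>1 - v2"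
    have v: "v1 + v2 = \<theta>1" "\<gamma> * v1 + \<gamma>' * v2 = \<theta>2"
    proof -
      have "(\<gamma>' - \<gamma>) * v2 = \<theta>2 - \<gamma> * \<theta>1" using gamma by (simp add: v2_def)
      thus "v1 + v2 = \<theta>1" "\<gamma> * v1 + \<gamma>' * v2 = \<theta>2" by (simp_all add: v1_def algebra_simps)
    qed
    have "r x * v1 + r' x * v2 = (of_int (fst x) + m1) * (v1 + v2) + (of_int (snd x) + m2) * (\<gamma> * v1 + \<gamma>' * v2)" for x
      by (simp add: r_def r'_def algebra_simps)
    hence rv: "of_real (r x) * of_real v1 + of_real (r' x) * of_real v2
        = (of_real (m1 * \<theta>1 + m2 * \<theta>2) + of_real (of_int (fst x) * \<theta>1 + of_int (snd x) * \<theta>2) :: complex)" for x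
      unfolding v of_real_mult[symmetric] of_real_add[symmetric] by (simp add: algebra_simps)
    have "summand x (of_real v1) (of_real v2) =
        e2pi (of_real (m1 * \<theta>1 + m2 * \<theta>2)) * (summand x 0 0 * e2pi (of_real (of_int (fst x) * \<theta>1 + of_int (snd x) * \<theta>2)))" for x
    proof -
      have "summand x (of_real v1) (of_real v2) = summand x 0 0 * e2pi (of_real (r x) * of_real v1 + of_real (r' x) * of_real v2)"
        by (simp add: summand_def e2pi_add mult_ac)
      thus ?thesis unfolding rv e2pi_add by (simp only: mult_ac)
    qed
    with zero[of "of_real v1" "of_real v2"]
    show "(\<Sum>\<^sub>\<infinity>x. summand x 0 0 * e2pi (of_real (of_int (fst x) * \<theta>1 + of_int (snd x) * \<theta>2))) = 0"
      by (simp add: \<Theta>_def infsum_cmult_right')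
  qed
  thus False using eps[of 0] by (auto simp: summand_def)
qed

end

section \<open>Arithmetic of the quadratic field\<close>

text \<open>The square of the reduced denominator of \<open>u\<close> has to divide
  \<open>D\<close>.\<close>

lemma squarefree_int_denominator:
  fixes D :: int and u :: real
  assumes "squarefree D" "u \<in> \<rat>" "of_int D * u\<^sup>2 \<in> \<int>"
  shows "u \<in> \<int>"
proof -
  obtain a b where ab: "b > 0" "coprime a b" "u = of_int a / of_int b"
    using Rats_cases'[OF \<open>u \<in> \<rat>\<close>] by metis
  obtain n where n: "of_int D * u\<^sup>2 = of_int n" using assms(3) by (auto elim: Ints_cases)
  have "of_int (D * a\<^sup>2) = (of_int (n * b\<^sup>2) :: real)"
    using n ab by (simp add: field_simps)
  hence "D * a\<^sup>2 = n * b\<^sup>2" by (simp only: of_int_eq_iff)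
  hence "b\<^sup>2 dvd D * a\<^sup>2" by simp
  hence "b\<^sup>2 dvd D" using ab(2) by (metis coprime_commute coprime_dvd_mult_left_iff coprime_power_left_iff coprime_power_right_iff)
  hence "b dvd 1" using assms(1) squarefreeD by blast
  with ab have "b = 1" by simp
  with ab show ?thesis by simp
qed

lemma poly_map_of_int_add:
  "poly (map_poly of_int (p + q)) (x :: real) = poly (map_poly of_int p) x + poly (map_poly of_int q) x"
  by (induction p q rule: poly_induct2) (simp_all add: map_poly_pCons algebra_simps)

lemma poly_map_of_int_mult:
  "poly (map_poly of_int (p * q)) (x :: real) = poly (map_poly of_int p) x * poly (map_poly of_int q) x"
  by (induction p) (simp_all add: map_poly_pCons poly_map_of_int_add map_poly_smult algebra_simps)

text \<open>Gauss's lemma: a primitive integer polynomial of degree 2 vanishing at an irrational algebraic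
  integer has leading coefficient \<open>\<plusminus>1\<close>.\<close>

lemma algebraic_int_quadratic:
  fixes x s n :: real
  assumes x: "algebraic_int x" "x \<notin> \<rat>" and sn: "s \<in> \<rat>" "n \<in> \<rat>" and eq: "x\<^sup>2 - s * x + n = 0"
  shows "s \<in> \<int>" "n \<in> \<int>"
proof -
  obtain f :: "int poly" where f: "poly (map_poly of_int f) x = 0" "lead_coeff f = 1"
    using x(1) by (auto simp: algebraic_int_altdef_ipoly)
  obtain a b where ab: "b > 0" "s = of_int a / of_int b" using Rats_cases'[OF sn(1)] by metis
  obtain c d where cd: "d > 0" "n = of_int c / of_int d" using Rats_cases'[OF sn(2)] by metis
  \<comment> \<open>The equation with denominators cleared; \<open>g\<close> is its primitive
    part.\<close>
  define h where "h = [: b * c, - (a * d), b * d :]"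
  define g where "g = primitive_part h"
  have h0: "h \<noteq> 0" using ab cd by (simp add: h_def)
  have hg: "h = smult (content h) g" by (simp add: g_def)
  have c0: "content h \<noteq> 0" using h0 by simp
  have "poly (map_poly of_int h) x = of_int b * of_int d * (x\<^sup>2 - s * x + n)"
    using ab cd by (simp add: h_def map_poly_pCons field_simps power2_eq_square)
  also have "\<dots> = 0" by (simp add: eq)
  finally have gx: "poly (map_poly of_int g) x = 0"
    using c0 by (subst (asm) hg) (simp add: map_poly_smult)
  have g0: "g \<noteq> 0" using h0 hg by auto
  have dg: "degree g = 2"
    using ab cd by (simp add: g_def h_def)
  have cg: "content g = 1" using h0 by (simp add: g_def)
  obtain q r where qr: "pseudo_divmod f g = (q, r)" by force
  define k where "k = coeff g (degree g) ^ (Suc (degree f) - degree g)"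
  have k: "k \<noteq> 0" using g0 by (simp add: k_def)
  have div: "smult k f = g * q + r" and r: "r = 0 \<or> degree r < 2"
    using pseudo_divmod[OF g0 qr] by (simp_all add: k_def dg)
  \<comment> \<open>A nonzero remainder would be a linear relation with integer coefficients for the
    irrational number \<open>x\<close>.\<close>
  have "r = 0"
  proof (rule ccontr)
    assume "r \<noteq> 0"
    with r have "degree r \<le> 1" by simp
    hence "coeff r k = coeff [: coeff r 0, coeff r 1 :] k" for k
      by (cases "k = 0"; cases "k = 1") (auto simp: coeff_pCons coeff_eq_0 split: nat.splits)
    then obtain r0 r1 where rr: "r = [: r0, r1 :]" using poly_eqI by blast
    have "poly (map_poly of_int (smult k f)) x = 0"
      using f by (simp add: map_poly_smult)
    moreover have "poly (map_poly of_int (g * q + r)) x = (of_int r0 + of_int r1 * x :: real)"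
    proof -
      have "poly (map_poly of_int (g * q + r)) x = poly (map_poly of_int g) x * poly (map_poly of_int q) x + poly (map_poly of_int r) x"
        by (simp add: poly_map_of_int_add poly_map_of_int_mult)
      thus ?thesis by (simp add: gx rr map_poly_pCons mult.commute)
    qed
    ultimately have lin: "of_int r0 + of_int r1 * x = 0" using div by simp
    have "r1 = 0"
    proof (rule ccontr)
      assume "r1 \<noteq> 0"
      with lin have "x = - of_int r0 / of_int r1" by (simp add: field_simps add_eq_0_iff)
      with x(2) show False by simp
    qed
    with lin rr \<open>r \<noteq> 0\<close> show False by simp
  qed
  hence fgq: "smult k f = g * q" using div by simp
  have "content f dvd lead_coeff f" by simp
  hence "content f = 1" using f(2) by (metis content_dvd_coeff content_dvd is_unit_content_iff normalize_1_iff normalize_content)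
  \<comment> \<open>Contents are multiplicative and those of \<open>f\<close> and \<open>g\<close>
    are 1, so the factor \<open>k\<close> of the pseudo-division can be cancelled.\<close>
  hence "content q = normalize k"
    using arg_cong[OF fgq, of content] cg by (simp add: content_mult)
  then obtain q' where q': "q = smult k q'"
    by (metis content_times_primitive_part normalize_int_def abs_if smult_minus_left smult_minus_right)
  have "smult k f = smult k (g * q')" using fgq q' by simp
  hence "f = g * q'" using k by (metis smult_cancel)
  hence "lead_coeff g * lead_coeff q' = 1" using f(2) by (simp add: lead_coeff_mult)
  hence "lead_coeff g dvd 1" by (metis dvd_triv_left)
  moreover have "b * d = content h * lead_coeff g"
    using hg ab cd by (metis coeff_smult h_def dg pCons_eq_iff degree_smult_eq c0 coeff_pCons_Suc coeff_pCons_0 numeral_2_eq_2)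
  \<comment> \<open>The leading coefficient of \<open>g\<close> is a unit, so \<open>b * d\<close>
    divides the content and with it every coefficient of \<open>h\<close>.\<close>
  ultimately have "content h dvd b * d" "b * d dvd content h"
    by (metis dvd_triv_left) (metis \<open>b * d = _\<close> \<open>lead_coeff g dvd 1\<close> dvd_refl mult_dvd_mono mult.right_neutral)
  have "content h dvd coeff h 1" "content h dvd coeff h 0" by (simp_all only: content_dvd_coeff)
  hence "b * d dvd a * d" "b * d dvd b * c"
    using \<open>b * d dvd content h\<close> dvd_trans by (fastforce simp: h_def)+
  hence "b dvd a" "d dvd c" using ab cd by simp_all
  thus "s \<in> \<int>" "n \<in> \<int>" using ab cd by auto
qed

section \<open>Conjugation, ring of integers and trace dual\<close>

locale real_quadratic =
  fixes D :: int
  assumes D_pos: "D > 0" and fund: "fundamental_discriminant D"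
begin

abbreviation w :: real where "w \<equiv> sqrt (of_int D)"
abbreviation cj :: "real \<Rightarrow> real" where "cj \<equiv> quad_conj D"
abbreviation K :: "real set" where "K \<equiv> quad_field D"
abbreviation \<O> :: "real set" where "\<O> \<equiv> ring_of_ints D"
abbreviation \<O>d :: "real set" where "\<O>d \<equiv> trace_dual D"

lemma w_square: "w * w = of_int D"
  using D_pos by simp

text \<open>A rational root would be an integer \<open>n\<close> with D = n^2. Squarefreeness then
  leaves D = 1, which is excluded, or D div 4 = 1, which is impossible modulo 4.\<close>

lemma w_irrational: "w \<notin> \<rat>"
proof
  assume "w \<in> \<rat>"
  moreover have "algebraic_int w" by (intro algebraic_int_sqrt int_imp_algebraic_int) simp
  ultimately have "w \<in> \<int>" by (simp add: rational_algebraic_int_is_int)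
  then obtain n where "w = of_int n" by (auto elim: Ints_cases)
  hence "real_of_int (n * n) = of_int D" using w_square by simp
  hence n: "D = n\<^sup>2" by (simp only: of_int_eq_iff power2_eq_square)
  show False
  proof (cases "4 dvd D")
    case False
    hence "squarefree D" "D \<noteq> 1" using fund by (auto simp: fundamental_discriminant_def)
    with n have "n dvd 1" using squarefreeD[of D n] by simp
    hence "n = 1 \<or> n = - 1" by auto
    with n \<open>D \<noteq> 1\<close> show False by auto
  next
    case True
    hence sq: "squarefree (D div 4)" "(D div 4) mod 4 \<in> {2, 3}"
      using fund by (auto simp: fundamental_discriminant_def)
    have "even n" using True n by (metis dvd_trans even_numeral even_power pos2)
    then obtain m where "n = 2 * m" by blast
    hence d: "D div 4 = m\<^sup>2" using n by (simp add: power_mult_distrib)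
    with sq have "m dvd 1" using squarefreeD[of "D div 4" m] by simp
    hence "m = 1 \<or> m = - 1" by auto
    with d sq show False by auto
  qed
qed

lemma quad_eq_iff:
  assumes "x \<in> \<rat>" "y \<in> \<rat>" "x' \<in> \<rat>" "y' \<in> \<rat>"
  shows "x + y * w = x' + y' * w \<longleftrightarrow> x = x' \<and> y = y'"
proof
  assume eq: "x + y * w = x' + y' * w"
  have "y = y'"
  proof (rule ccontr)
    assume "y \<noteq> y'"
    with eq have "w = (x' - x) / (y - y')" by (simp add: field_simps)
    with w_irrational assms show False by simp
  qed
  with eq show "x = x' \<and> y = y'" by simp
qed simp

lemma quad_conj_eq:
  assumes "x \<in> \<rat>" "y \<in> \<rat>"
  shows "cj (x + y * w) = x - y * w"
  unfolding quad_conj_def using assms quad_eq_iff by (intro the_equality) auto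

lemma quad_fieldE:
  assumes "z \<in> K"
  obtains x y where "x \<in> \<rat>" "y \<in> \<rat>" "z = x + y * w" "cj z = x - y * w"
  using assms unfolding quad_field_def using quad_conj_eq by blast

lemma quad_fieldI: "x \<in> \<rat> \<Longrightarrow> y \<in> \<rat> \<Longrightarrow> x + y * w \<in> K"
  by (auto simp: quad_field_def)

lemma conj_rat: "x \<in> \<rat> \<Longrightarrow> cj x = x" and rat_in_K: "x \<in> \<rat> \<Longrightarrow> x \<in> K"
  using quad_conj_eq[of x 0] quad_fieldI[of x 0] by auto

lemma conj_0 [simp]: "cj 0 = 0" and conj_1 [simp]: "cj 1 = 1"
  by (simp_all add: conj_rat)

lemma
  assumes "z \<in> K" "z' \<in> K"
  shows add_in_K: "z + z' \<in> K" and conj_add: "cj (z + z') = cj z + cj z'"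
    and diff_in_K: "z - z' \<in> K" and conj_diff: "cj (z - z') = cj z - cj z'"
    and mult_in_K: "z * z' \<in> K" and conj_mult: "cj (z * z') = cj z * cj z'"
proof -
  obtain x y where z: "x \<in> \<rat>" "y \<in> \<rat>" "z = x + y * w" "cj z = x - y * w"
    using quad_fieldE assms(1) by blast
  obtain x' y' where z': "x' \<in> \<rat>" "y' \<in> \<rat>" "z' = x' + y' * w" "cj z' = x' - y' * w"
    using quad_fieldE assms(2) by blast
  have "z + z' = (x + x') + (y + y') * w" by (simp add: z z' algebra_simps)
  thus "z + z' \<in> K" "cj (z + z') = cj z + cj z'"
    using quad_fieldI[of "x + x'" "y + y'"] quad_conj_eq[of "x + x'" "y + y'"] z z' by (auto simp: algebra_simps)
  have "z - z' = (x - x') + (y - y') * w" by (simp add: z z' algebra_simps)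
  thus "z - z' \<in> K" "cj (z - z') = cj z - cj z'"
    using quad_fieldI[of "x - x'" "y - y'"] quad_conj_eq[of "x - x'" "y - y'"] z z' by (auto simp: algebra_simps)
  have "z * z' = x * x' + y * y' * (w * w) + (x * y' + x' * y) * w"
    unfolding z(3) z'(3) by (simp only: algebra_simps)
  hence e: "z * z' = (x * x' + y * y' * of_int D) + (x * y' + x' * y) * w" unfolding w_square .
  have "cj z * cj z' = x * x' + y * y' * (w * w) - (x * y' + x' * y) * w"
    unfolding z(4) z'(4) by (simp only: algebra_simps)
  hence e': "cj z * cj z' = (x * x' + y * y' * of_int D) - (x * y' + x' * y) * w" unfolding w_square .
  show "z * z' \<in> K" unfolding e by (rule quad_fieldI) (use z z' in auto)
  show "cj (z * z') = cj z * cj z'" unfolding e e' by (rule quad_conj_eq) (use z z' in auto)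
qed

text \<open>Integrality of the norm (D^2 - D) / 4 of \<open>gamma0 D\<close>.\<close>

lemma four_dvd: "4 dvd D * D - D"
proof -
  have "D mod 4 = 0 \<or> D mod 4 = 1" using fund by (auto simp: fundamental_discriminant_def)
  thus ?thesis
  proof
    assume "D mod 4 = 0"
    hence "4 dvd D" by auto
    thus ?thesis by simp
  next
    assume "D mod 4 = 1"
    hence "4 dvd D - 1" by presburger
    moreover have "D * D - D = D * (D - 1)" by (simp add: algebra_simps)
    ultimately show ?thesis by simp
  qed
qed

lemma gamma0_square: "gamma0 D * gamma0 D = of_int D * gamma0 D - of_int ((D * D - D) div 4)"
proof -
  obtain k where k: "D * D - D = 4 * k" using four_dvd by blast
  hence "of_int D * of_int D - of_int D = 4 * real_of_int k" by (metis of_int_diff of_int_mult of_int_numeral)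
  thus ?thesis using w_square k by (simp add: gamma0_def field_simps)
qed

lemma gamma0_in_K: "gamma0 D \<in> K" and conj_gamma0: "cj (gamma0 D) = (of_int D - w) / 2"
  using quad_fieldI[of "of_int D / 2" "1/2"] quad_conj_eq[of "of_int D / 2" "1/2"]
  by (simp_all add: gamma0_def field_simps)

lemma int_comb_in_K: "of_int i + of_int j * gamma0 D \<in> K"
  by (intro add_in_K mult_in_K gamma0_in_K rat_in_K) auto

lemma conj_int_comb: "cj (of_int i + of_int j * gamma0 D) = of_int i + of_int j * ((of_int D - w) / 2)"
  using gamma0_in_K by (simp add: conj_add conj_mult rat_in_K mult_in_K conj_rat conj_gamma0)

lemma int_comb_algebraic: "algebraic_int (of_int i + of_int j * gamma0 D)"
proof -
  define x where "x = of_int i + of_int j * gamma0 D"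
  \<comment> \<open>\<open>s\<close> and \<open>n\<close> are the trace and the norm of
    \<open>x\<close>.\<close>
  define s where "s = 2 * i + j * D"
  define n where "n = i * i + i * j * D + j * j * ((D * D - D) div 4)"
  define g where "g = gamma0 D"
  have g: "g * g = of_int D * g - of_int ((D * D - D) div 4)" unfolding g_def by (rule gamma0_square)
  have "x * x - of_int s * x + of_int n =
      of_int j * of_int j * (g * g - of_int D * g + of_int ((D * D - D) div 4))"
    unfolding x_def s_def n_def g_def[symmetric] of_int_add of_int_mult by (simp add: algebra_simps)
  also have "\<dots> = 0" unfolding g by simp
  finally have "poly [: of_int n, - of_int s, 1 :] x = 0" by (simp add: algebra_simps)
  moreover have "\<forall>k. coeff [: of_int n, - of_int s, 1 :: real :] k \<in> \<int>"
    by (auto simp: coeff_pCons split: nat.splits)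
  ultimately show ?thesis unfolding x_def[symmetric] by (intro algebraic_int.intros[of "[: of_int n, - of_int s, 1 :]"]) auto
qed

text \<open>For x = p + q sqrt D the trace t = 2 p and the norm n are integers, and D (2 q)^2 = t^2
  - 4 n. Once 2 q is an integer j with t - j D even, x = (t - j D) / 2 + j \<open>gamma0 D\<close>.
  This basis identifies the translations by \<O> with the index shifts of \<Theta>.\<close>

lemma ring_of_ints_eq: "\<O> = {of_int i + of_int j * gamma0 D | i j. True}"
proof (intro equalityI subsetI)
  fix x assume "x \<in> {of_int i + of_int j * gamma0 D | i j. True}"
  thus "x \<in> \<O>" using int_comb_in_K int_comb_algebraic by (auto simp: ring_of_ints_def)
next
  fix x assume "x \<in> \<O>"
  hence alg: "algebraic_int x" and "x \<in> K" by (simp_all add: ring_of_ints_def)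
  then obtain p q where pq: "p \<in> \<rat>" "q \<in> \<rat>" "x = p + q * w" using quad_fieldE by metis
  show "x \<in> {of_int i + of_int j * gamma0 D | i j. True}"
  proof (cases "q = 0")
    case True
    hence "x \<in> \<int>" using alg pq by (simp add: rational_algebraic_int_is_int)
    then obtain i where "x = of_int i" by (auto elim: Ints_cases)
    hence "x = of_int i + of_int 0 * gamma0 D" by simp
    thus ?thesis by blast
  next
    case False
    have irr: "x \<notin> \<rat>"
    proof
      assume "x \<in> \<rat>"
      moreover have "w = (x - p) / q" using False pq by simp
      ultimately have "w \<in> \<rat>" using pq(1,2) by (metis Rats_diff Rats_divide)
      thus False using w_irrational by blast
    qed
    have "x\<^sup>2 - 2 * p * x + (p * p - of_int D * (q * q)) = q * q * (w * w - of_int D)"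
      unfolding pq power2_eq_square by (simp only: algebra_simps)
    hence "x\<^sup>2 - 2 * p * x + (p * p - of_int D * (q * q)) = 0" unfolding w_square by simp
    from algebraic_int_quadratic[OF alg irr _ _ this] pq
    obtain t n where tn: "2 * p = of_int t" "p * p - of_int D * (q * q) = of_int n"
      by (auto elim!: Ints_cases)
    have Dq: "of_int D * (2 * q)\<^sup>2 = of_int (t * t - 4 * n)"
    proof -
      have "of_int (t * t - 4 * n) = (2 * p) * (2 * p) - 4 * (p * p - of_int D * (q * q))"
        by (simp only: tn of_int_diff of_int_mult of_int_numeral)
      thus ?thesis by (simp add: power2_eq_square algebra_simps)
    qed
    have "\<exists>j. 2 * q = of_int j \<and> even (t - j * D)"
    proof (cases "4 dvd D")
      case False
      hence sq: "squarefree D" "D mod 4 = 1" using fund by (auto simp: fundamental_discriminant_def)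
      have "2 * q \<in> \<int>"
        by (rule squarefree_int_denominator[OF sq(1)]) (use pq Dq in auto)
      then obtain j where j: "2 * q = of_int j" by (auto elim: Ints_cases)
      with Dq have "real_of_int (D * j\<^sup>2) = of_int (t * t - 4 * n)" by simp
      hence e: "D * j\<^sup>2 = t * t - 4 * n" by (simp only: of_int_eq_iff)
      have "odd D" using sq by presburger
      hence "even (t * t - 4 * n) \<longleftrightarrow> even j" using e by (metis even_mult_iff even_power pos2)
      hence "even t \<longleftrightarrow> even j" by simp
      with \<open>odd D\<close> j show ?thesis by (intro exI[of _ j]) simp
    next
      case True
      define d where "d = D div 4"
      have d: "D = 4 * d" using True by (simp add: d_def)
      have sq: "squarefree d" "d mod 4 = 2 \<or> d mod 4 = 3"
        using fund True by (auto simp: fundamental_discriminant_def d_def)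
      \<comment> \<open>Here \<open>d\<close> is squarefree rather than \<open>D\<close>, so at
        first only \<open>4 * q\<close> is seen to be integral.\<close>
      have dq: "of_int d * (4 * q)\<^sup>2 = real_of_int (t * t - 4 * n)"
        using Dq by (simp add: d power_mult_distrib)
      have "4 * q \<in> \<int>"
        by (rule squarefree_int_denominator[OF sq(1)]) (use pq dq in auto)
      then obtain u where u: "4 * q = of_int u" by (auto elim: Ints_cases)
      with dq have "real_of_int (d * u\<^sup>2) = of_int (t * t - 4 * n)" by simp
      hence e: "d * (u * u) = t * t - 4 * n" by (simp only: of_int_eq_iff power2_eq_square)
      \<comment> \<open>Squares are 0 or 1 modulo 4, and \<open>d\<close> is 2 or 3 there.\<close>
      have "even u \<and> even t"
      proof (rule ccontr)
        assume na: "\<not> (even u \<and> even t)"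
        have sqmod: "y * y mod 4 = (if even y then 0 else 1)" for y :: int
        proof (cases "even y")
          case False
          then obtain k where "y = 2 * k + 1" by (auto elim: oddE)
          hence "y * y = 4 * (k * k + k) + 1" by (simp add: algebra_simps)
          thus ?thesis using False by presburger
        qed (auto elim!: evenE simp: mult.assoc)
        have "(d mod 4) * (u * u mod 4) mod 4 = (t * t - 4 * n) mod 4"
          by (simp add: mod_mult_eq e)
        also have "\<dots> = t * t mod 4" by presburger
        finally show False using na sq(2) by (auto simp: sqmod split: if_splits)
      qed
      then obtain j where "u = 2 * j" by blast
      hence "2 * q = of_int j" using u by simp
      moreover have "even (t - j * D)" using \<open>even u \<and> even t\<close> d by simp
      ultimately show ?thesis by blast
    qed
    then obtain j i where j: "2 * q = of_int j" "t - j * D = 2 * i" by blast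
    have "of_int t = of_int j * of_int D + 2 * (of_int i :: real)"
      using j(2) by (metis add.commute diff_add_cancel of_int_add of_int_mult of_int_numeral)
    hence "x = of_int i + of_int j * gamma0 D"
      using tn(1) j(1) by (simp add: pq gamma0_def field_simps)
    thus ?thesis by blast
  qed
qed

lemma ring_of_intsE:
  assumes "x \<in> \<O>"
  obtains i j where "x = of_int i + of_int j * gamma0 D" "cj x = of_int i + of_int j * ((of_int D - w) / 2)"
  using assms conj_int_comb unfolding ring_of_ints_eq by blast

lemma ring_of_intsI: "of_int i + of_int j * gamma0 D \<in> \<O>"
  unfolding ring_of_ints_eq by blast

lemma O_in_K: "x \<in> \<O> \<Longrightarrow> x \<in> K" and Od_in_K: "x \<in> \<O>d \<Longrightarrow> x \<in> K"
  and inv_in_K: "x \<in> inv_trace_dual D \<Longrightarrow> x \<in> K"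
  by (simp_all add: ring_of_ints_def trace_dual_def inv_trace_dual_def)

lemma
  assumes "x \<in> \<O>" "y \<in> \<O>"
  shows O_add: "x + y \<in> \<O>" and O_diff: "x - y \<in> \<O>" and O_mult: "x * y \<in> \<O>"
proof -
  obtain i j where x: "x = of_int i + of_int j * gamma0 D" using assms(1) ring_of_intsE by blast
  obtain i' j' where y: "y = of_int i' + of_int j' * gamma0 D" using assms(2) ring_of_intsE by blast
  show "x + y \<in> \<O>" using ring_of_intsI[of "i + i'" "j + j'"] by (simp add: x y algebra_simps)
  show "x - y \<in> \<O>" using ring_of_intsI[of "i - i'" "j - j'"] by (simp add: x y algebra_simps)
  have "x * y = of_int i * of_int i' + (of_int i * of_int j' + of_int i' * of_int j) * gamma0 D
      + of_int j * of_int j' * (gamma0 D * gamma0 D)"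
    unfolding x y by (simp add: algebra_simps)
  also have "\<dots> = of_int (i * i' - j * j' * ((D * D - D) div 4)) + of_int (i * j' + i' * j + j * j' * D) * gamma0 D"
    unfolding gamma0_square of_int_add of_int_diff of_int_mult by (simp add: algebra_simps)
  finally have e: "x * y = \<dots>" .
  show "x * y \<in> \<O>" unfolding e by (rule ring_of_intsI)
qed

lemma
  assumes "b \<in> \<O>d" "b' \<in> \<O>d"
  shows Od_add: "b + b' \<in> \<O>d" and Od_diff: "b - b' \<in> \<O>d"
proof -
  have K: "b \<in> K" "b' \<in> K" using assms Od_in_K by auto
  have "quad_trace D ((b + b') * y) \<in> \<int> \<and> quad_trace D ((b - b') * y) \<in> \<int>" if y: "y \<in> \<O>" for y
  proof -
    have yK: "y \<in> K" using y by (rule O_in_K)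
    have "quad_trace D (b * y) \<in> \<int>" "quad_trace D (b' * y) \<in> \<int>"
      using assms y by (auto simp: trace_dual_def)
    moreover have "quad_trace D ((b + b') * y) = quad_trace D (b * y) + quad_trace D (b' * y)"
      "quad_trace D ((b - b') * y) = quad_trace D (b * y) - quad_trace D (b' * y)"
      using conj_add[OF mult_in_K[OF K(1) yK] mult_in_K[OF K(2) yK]]
        conj_diff[OF mult_in_K[OF K(1) yK] mult_in_K[OF K(2) yK]]
      by (simp_all add: quad_trace_def algebra_simps)
    ultimately show ?thesis by simp
  qed
  thus "b + b' \<in> \<O>d" "b - b' \<in> \<O>d"
    using add_in_K[OF K] diff_in_K[OF K] by (auto simp: trace_dual_def)
qed

lemma Od_mult:
  assumes "a \<in> \<O>" "b \<in> \<O>d"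
  shows "a * b \<in> \<O>d"
proof -
  have "quad_trace D (a * b * y) \<in> \<int>" if "y \<in> \<O>" for y
    using assms(2) O_mult[OF assms(1) that] by (auto simp: trace_dual_def mult_ac)
  thus ?thesis using mult_in_K[OF O_in_K[OF assms(1)] Od_in_K[OF assms(2)]] by (auto simp: trace_dual_def)
qed

lemma inv_mult:
  assumes "c \<in> inv_trace_dual D" "b \<in> \<O>d"
  shows "c * b \<in> \<O>"
  using assms by (auto simp: inv_trace_dual_def)

text \<open>The integrality conditions of \<open>Theta_translate\<close>, obtained by testing
  against the basis 1, \<open>gamma0 D\<close>.\<close>

lemma Od_trace:
  assumes "b \<in> \<O>d"
  shows "b + cj b \<in> \<int>" "gamma0 D * b + (of_int D - w) / 2 * cj b \<in> \<int>"
proof -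
  have "quad_trace D (b * 1) \<in> \<int>" "quad_trace D (b * gamma0 D) \<in> \<int>"
    using assms ring_of_intsI[of 1 0] ring_of_intsI[of 0 1] by (auto simp: trace_dual_def)
  thus "b + cj b \<in> \<int>" "gamma0 D * b + (of_int D - w) / 2 * cj b \<in> \<int>"
    using Od_in_K[OF assms] gamma0_in_K by (simp_all add: quad_trace_def conj_mult conj_gamma0 mult.commute)
qed

end

section \<open>The abelian surfaces\<close>

lemma surface_point_nth [simp]:
  "surface_point D z a b $ 1 = of_real a * fst z + of_real b"
  "surface_point D z a b $ 2 = of_real (quad_conj D a) * snd z + of_real (quad_conj D b)"
  by (simp_all add: surface_point_def)

text \<open>Makes the coordinates of a lattice point unique, and excludes a nonzero lattice vector
  with first coordinate 0.\<close>

lemma real_lin_eq_iff: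
  assumes "Im z > 0"
  shows "of_real a * z + of_real b = of_real a' * z + of_real b' \<longleftrightarrow> a = a' \<and> b = b'"
proof
  assume eq: "of_real a * z + of_real b = of_real a' * z + of_real b'"
  from arg_cong[OF eq, of Im] assms have "a = a'" by simp
  with eq show "a = a' \<and> b = b'" by simp
qed simp

lemma surface_point_eq_iff:
  assumes "z \<in> HH"
  shows "surface_point D z a b = surface_point D z a' b' \<longleftrightarrow> a = a' \<and> b = b'"
proof
  assume "surface_point D z a b = surface_point D z a' b'"
  hence "surface_point D z a b $ 1 = surface_point D z a' b' $ 1" by simp
  thus "a = a' \<and> b = b'" using assms real_lin_eq_iff[of "fst z" a b a' b'] by (simp add: HH_def)
qed simp

lemma surface_point_in_lattice:
  "a \<in> ring_of_ints D \<Longrightarrow> b \<in> trace_dual D \<Longrightarrow> surface_point D z a b \<in> surface_lattice D z"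
  unfolding surface_lattice_def by blast

lemma surface_form_eq:
  assumes "z \<in> HH" "a \<in> ring_of_ints D" "b \<in> trace_dual D" "a' \<in> ring_of_ints D" "b' \<in> trace_dual D"
  shows "surface_form D z (surface_point D z a b) (surface_point D z a' b') = quad_trace D (a * b' - a' * b)"
  unfolding surface_form_def using assms by (intro the_equality) (auto simp: surface_point_eq_iff)

lemma moebius_denominator_nonzero:
  assumes "Im z > 0" "a * d - b * c = 1"
  shows "of_real c * z + of_real d \<noteq> 0"
proof
  assume "of_real c * z + of_real d = 0"
  hence "of_real c * z + of_real d = of_real 0 * z + of_real 0" by simp
  with assms real_lin_eq_iff[of z c d 0 0] show False by auto
qed

lemma polarized_iso_trans:
  assumes "polarized_iso S T" "polarized_iso T U"
  shows "polarized_iso S U"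
proof -
  obtain L1 E1 L2 E2 L3 E3 where eq: "S = (L1, E1)" "T = (L2, E2)" "U = (L3, E3)"
    by (metis surj_pair)
  obtain A where A: "invertible A" "(\<lambda>v. A *v v) ` L1 = L2"
      "\<forall>u\<in>L1. \<forall>v\<in>L1. E2 (A *v u) (A *v v) = E1 u v"
    using assms(1) by (auto simp: polarized_iso_def eq)
  obtain B where B: "invertible B" "(\<lambda>v. B *v v) ` L2 = L3"
      "\<forall>u\<in>L2. \<forall>v\<in>L2. E3 (B *v u) (B *v v) = E2 u v"
    using assms(2) by (auto simp: polarized_iso_def eq)
  have "(\<lambda>v. (B ** A) *v v) ` L1 = L3"
    by (simp add: A(2)[symmetric] B(2)[symmetric] image_image matrix_vector_mul_assoc)
  moreover have "E3 ((B ** A) *v u) ((B ** A) *v v) = E1 u v" if "u \<in> L1" "v \<in> L1" for u v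
    using A B that by (simp flip: matrix_vector_mul_assoc) (metis image_eqI)
  ultimately show ?thesis
    unfolding polarized_iso_def eq using invertible_mult[OF B(1) A(1)] by auto
qed

lemma polarized_iso_sym:
  assumes "polarized_iso S T"
  shows "polarized_iso T S"
proof -
  obtain L1 E1 L2 E2 where eq: "S = (L1, E1)" "T = (L2, E2)"
    by (metis surj_pair)
  obtain A where A: "invertible A" "(\<lambda>v. A *v v) ` L1 = L2"
      "\<forall>u\<in>L1. \<forall>v\<in>L1. E2 (A *v u) (A *v v) = E1 u v"
    using assms(1) by (auto simp: polarized_iso_def eq)
  obtain B where B: "A ** B = mat 1" "B ** A = mat 1"
    using A(1) by (auto simp: invertible_def)
  have BA: "B *v (A *v v) = v" for v by (simp add: matrix_vector_mul_assoc B)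
  have "invertible B" using B by (auto simp: invertible_def)
  moreover have "(\<lambda>v. B *v v) ` L2 = L1"
    by (simp add: A(2)[symmetric] image_image BA)
  moreover have "\<forall>u\<in>L2. \<forall>v\<in>L2. E1 (B *v u) (B *v v) = E2 u v"
    using A(3) by (simp add: A(2)[symmetric] BA)
  ultimately show ?thesis unfolding polarized_iso_def eq by auto
qed

lemma reducible_polarized_iso:
  assumes "polarized_iso S T"
  shows "reducible S \<longleftrightarrow> reducible T"
  using assms polarized_iso_trans polarized_iso_sym unfolding reducible_def by blast

section \<open>Invariance of reducibility along orbits\<close>

context real_quadratic
begin

lemma SL_dual_conj_det:
  assumes "g \<in> SL_dual D"
  shows "g$1$1 * g$2$2 - g$1$2 * g$2$1 = 1" "cj (g$1$1) * cj (g$2$2) - cj (g$1$2) * cj (g$2$1) = 1"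
proof -
  have g: "g$1$1 \<in> K" "g$1$2 \<in> K" "g$2$1 \<in> K" "g$2$2 \<in> K"
    using assms O_in_K Od_in_K inv_in_K by (auto simp: SL_dual_def)
  show 1: "g$1$1 * g$2$2 - g$1$2 * g$2$1 = 1"
    using assms by (simp add: SL_dual_def det_2)
  have "cj (g$1$1 * g$2$2 - g$1$2 * g$2$1) = 1" unfolding 1 by simp
  thus "cj (g$1$1) * cj (g$2$2) - cj (g$1$2) * cj (g$2$1) = 1"
    using g by (simp add: conj_diff conj_mult mult_in_K)
qed

text \<open>Dividing by the cocycle (j1, j2) sends the lattice of \<open>z\<close> to that of
  \<open>act D g z\<close>. On coordinates this corresponds to right multiplication of the row (a,
  b) by \<open>g\<close>, which preserves \<O> \<oplus> \<O>d by the conditions on the entries, and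
  the alternating form because the determinant is 1.\<close>

lemma surface_act_iso:
  assumes z: "z \<in> HH" and w: "act D g z \<in> HH" and g: "g \<in> SL_dual D"
  shows "polarized_iso (surface D z) (surface D (act D g z))"
proof -
  define p q r s where "p = g$1$1" "q = g$1$2" "r = g$2$1" "s = g$2$2"
  have mem: "p \<in> \<O>" "q \<in> \<O>d" "r \<in> inv_trace_dual D" "s \<in> \<O>"
    using g by (auto simp: SL_dual_def p_q_r_s_def)
  have memK: "p \<in> K" "q \<in> K" "r \<in> K" "s \<in> K" using mem O_in_K Od_in_K inv_in_K by auto
  have det: "p * s - q * r = 1" "cj p * cj s - cj q * cj r = 1"
    using SL_dual_conj_det[OF g] by (simp_all add: p_q_r_s_def)
  define j1 where "j1 = of_real r * fst z + of_real s"
  define j2 where "j2 = of_real (cj r) * snd z + of_real (cj s)"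
  have j: "j1 \<noteq> 0" "j2 \<noteq> 0"
    using z moebius_denominator_nonzero[of "fst z" p s q r] moebius_denominator_nonzero[of "snd z" "cj p" "cj s" "cj q" "cj r"] det
    by (auto simp: j1_def j2_def HH_def)
  have actg: "act D g z = ((of_real p * fst z + of_real q) / j1, (of_real (cj p) * snd z + of_real (cj q)) / j2)"
    by (simp add: act_def moebius_def map_matrix_def j1_def j2_def p_q_r_s_def)
  define A :: "complex^2^2" where "A = vector [vector [1 / j1, 0], vector [0, 1 / j2]]"
  define fa where "fa a b = a * p + b * r" for a b
  define fb where "fb a b = a * q + b * s" for a b
  have fmem: "fa a b \<in> \<O>" "fb a b \<in> \<O>d" if "a \<in> \<O>" "b \<in> \<O>d" for a b
    unfolding fa_def fb_def using that mem inv_mult[of r b] Od_mult[of s b]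
    by (auto intro!: O_add Od_add intro: O_mult Od_mult simp: mult.commute)
  have Av: "(A *v v) $ 1 = v $ 1 / j1" "(A *v v) $ 2 = v $ 2 / j2" for v
    by (simp_all add: A_def matrix_vector_mult_def sum_2)
  have key: "A *v surface_point D z (fa a b) (fb a b) = surface_point D (act D g z) a b"
    if "a \<in> \<O>" "b \<in> \<O>d" for a b
  proof -
    have ab: "a \<in> K" "b \<in> K" using that O_in_K Od_in_K by auto
    have c: "cj (fa a b) = cj a * cj p + cj b * cj r" "cj (fb a b) = cj a * cj q + cj b * cj s"
      using ab memK by (simp_all add: fa_def fb_def conj_add conj_mult mult_in_K)
    have "(of_real (fa a b) * fst z + of_real (fb a b)) / j1
      = of_real a * ((of_real p * fst z + of_real q) / j1) + of_real b * (j1 / j1)"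
      unfolding times_divide_eq_right add_divide_distrib[symmetric]
      by (rule arg_cong[of _ _ "\<lambda>x. x / j1"]) (simp add: fa_def fb_def j1_def algebra_simps)
    moreover have "(of_real (cj (fa a b)) * snd z + of_real (cj (fb a b))) / j2
      = of_real (cj a) * ((of_real (cj p) * snd z + of_real (cj q)) / j2) + of_real (cj b) * (j2 / j2)"
      unfolding times_divide_eq_right add_divide_distrib[symmetric]
      by (rule arg_cong[of _ _ "\<lambda>x. x / j2"]) (simp add: c j2_def algebra_simps)
    ultimately show ?thesis using j by (simp add: vec_eq_iff forall_2 Av actg)
  qed
  \<comment> \<open>The witnesses come from the inverse matrix of \<open>g\<close>.\<close>
  have surj: "\<exists>a\<in>\<O>. \<exists>b\<in>\<O>d. fa a b = a' \<and> fb a b = b'" if ab: "a' \<in> \<O>" "b' \<in> \<O>d" for a' b'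
  proof (intro bexI conjI)
    have "fa (a' * s - b' * r) (b' * p - a' * q) = a' * (p * s - q * r)"
      "fb (a' * s - b' * r) (b' * p - a' * q) = b' * (p * s - q * r)"
      by (simp_all add: fa_def fb_def algebra_simps)
    thus "fa (a' * s - b' * r) (b' * p - a' * q) = a'" "fb (a' * s - b' * r) (b' * p - a' * q) = b'"
      by (simp_all only: det mult_1_right)
    show "a' * s - b' * r \<in> \<O>" "b' * p - a' * q \<in> \<O>d"
      using ab mem inv_mult[of r b'] Od_mult[of p b']
      by (auto intro!: O_diff Od_diff intro: O_mult Od_mult simp: mult.commute)
  qed
  have "invertible A"
  proof -
    have "det A \<noteq> 0" using j by (simp add: det_2 A_def)
    thus ?thesis by (simp add: invertible_det_nz)
  qed
  moreover have "(\<lambda>v. A *v v) ` surface_lattice D z = surface_lattice D (act D g z)"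
  proof (intro equalityI subsetI)
    fix u assume "u \<in> (\<lambda>v. A *v v) ` surface_lattice D z"
    then obtain a' b' where "a' \<in> \<O>" "b' \<in> \<O>d" "u = A *v surface_point D z a' b'"
      by (auto simp: surface_lattice_def)
    moreover from surj[OF this(1,2)] obtain a b where "a \<in> \<O>" "b \<in> \<O>d" "fa a b = a'" "fb a b = b'" by blast
    ultimately show "u \<in> surface_lattice D (act D g z)" using key[of a b] by (auto simp: surface_lattice_def)
  next
    fix u assume "u \<in> surface_lattice D (act D g z)"
    then obtain a b where ab: "a \<in> \<O>" "b \<in> \<O>d" "u = surface_point D (act D g z) a b"
      by (auto simp: surface_lattice_def)
    hence "u = A *v surface_point D z (fa a b) (fb a b)" using key by simp
    moreover have "surface_point D z (fa a b) (fb a b) \<in> surface_lattice D z"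
      by (intro surface_point_in_lattice fmem ab)
    ultimately show "u \<in> (\<lambda>v. A *v v) ` surface_lattice D z" by blast
  qed
  moreover have "surface_form D (act D g z) (A *v u) (A *v v) = surface_form D z u v"
    if uv: "u \<in> surface_lattice D z" "v \<in> surface_lattice D z" for u v
  proof -
    obtain a' b' c' d' where "a' \<in> \<O>" "b' \<in> \<O>d" "c' \<in> \<O>" "d' \<in> \<O>d"
      "u = surface_point D z a' b'" "v = surface_point D z c' d'"
      using uv by (auto simp: surface_lattice_def)
    with surj[of a' b'] surj[of c' d'] obtain a b c d where m: "a \<in> \<O>" "b \<in> \<O>d" "c \<in> \<O>" "d \<in> \<O>d"
      and uv: "u = surface_point D z (fa a b) (fb a b)" "v = surface_point D z (fa c d) (fb c d)" by metis
    have "fa a b * fb c d - fa c d * fb a b = (a * d - c * b) * (p * s - q * r)"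
      by (simp add: fa_def fb_def algebra_simps)
    thus ?thesis
      unfolding uv using m fmem z w by (simp add: key surface_form_eq det)
  qed
  ultimately show ?thesis
    unfolding polarized_iso_def surface_def by auto
qed

text \<open>Both points are images of one representative \<open>x\<close>, so their surfaces are
  compared through that of \<open>x\<close>.\<close>

lemma reducible_orbit:
  assumes "c \<in> X_surface D" "z \<in> c" "z' \<in> c"
  shows "z \<in> HH" "reducible (surface D z) \<longleftrightarrow> reducible (surface D z')"
proof -
  obtain x where c: "c = orbit_rel D `` {x}" using assms(1) unfolding X_surface_def by (rule quotientE)
  from assms(2,3)[unfolded c] obtain g h where
    "x \<in> HH" "z \<in> HH" "z' \<in> HH" "g \<in> SL_dual D" "h \<in> SL_dual D" "z = act D g x" "z' = act D h x"
    by (auto simp: orbit_rel_def)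
  with surface_act_iso[of x g] surface_act_iso[of x h] reducible_polarized_iso
  show "z \<in> HH" "reducible (surface D z) \<longleftrightarrow> reducible (surface D z')" by blast+
qed

end

section \<open>Normalized periods of a principally polarized elliptic curve\<close>

lemma lattice_complex1:
  fixes L :: "(complex^1) set"
  assumes "is_lattice L"
  obtains \<alpha> \<beta> where "L = {of_int i *\<^sub>R \<alpha> + of_int j *\<^sub>R \<beta> | i j. True}" "independent {\<alpha>, \<beta>}" "\<alpha> \<noteq> \<beta>" "span {\<alpha>, \<beta>} = UNIV"
proof -
  obtain B where B: "finite B" "independent B" "span B = (UNIV :: (complex^1) set)"
    "L = range (\<lambda>c :: complex^1 \<Rightarrow> int. \<Sum>b\<in>B. of_int (c b) *\<^sub>R b)"
    using assms by (auto simp: is_lattice_def)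
  have "card B = dim (UNIV :: (complex^1) set)" using B by (metis dim_span_eq_card_independent)
  hence "card B = 2" by simp
  then obtain \<alpha> \<beta> where ab: "B = {\<alpha>, \<beta>}" "\<alpha> \<noteq> \<beta>" by (auto simp: card_2_iff)
  have "L = {of_int i *\<^sub>R \<alpha> + of_int j *\<^sub>R \<beta> | i j. True}"
  proof (intro equalityI subsetI)
    fix u assume "u \<in> {of_int i *\<^sub>R \<alpha> + of_int j *\<^sub>R \<beta> | i j. True}"
    then obtain i j where "u = of_int i *\<^sub>R \<alpha> + of_int j *\<^sub>R \<beta>" by blast
    hence "u = (\<Sum>b\<in>B. of_int ((\<lambda>b. if b = \<alpha> then i else j) b) *\<^sub>R b)" using ab by simp
    thus "u \<in> L" unfolding B(4) by (rule range_eqI[of _ _ "\<lambda>b. if b = \<alpha> then i else j"])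
  qed (use ab B(4) in auto)
  thus thesis using that ab B by auto
qed

text \<open>On a lattice basis the form has the value 1 or -1, and exchanging the basis vectors
  gives -1; by positivity this sign means Im \<tau> > 0. The values at 0 are recorded because
  \<open>torus_prod\<close> evaluates both forms on vectors with a zero coordinate.\<close>

lemma ppav_complex1:
  fixes L :: "(complex^1) set"
  assumes "ppav (L, E)"
  obtains \<alpha> \<tau> where "\<alpha> \<noteq> 0" "\<alpha> \<in> L" "\<tau> *s \<alpha> \<in> L" "E \<alpha> (\<tau> *s \<alpha>) = - 1" "0 \<in> L" "E 0 0 = 0"
    "E \<alpha> 0 = 0" "E 0 \<alpha> = 0" "E (\<tau> *s \<alpha>) 0 = 0" "E 0 (\<tau> *s \<alpha>) = 0"
proof -
  obtain F where F: "bilinear F" "\<forall>u\<in>L. \<forall>v\<in>L. F u v = E u v" "\<forall>u. F u u = 0"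
    "\<forall>u. u \<noteq> 0 \<longrightarrow> F (\<i> *s u) u > 0" "{v. \<forall>u\<in>L. F u v \<in> \<int>} = L" and lat: "is_lattice L"
    using assms by (auto simp: ppav_def)
  obtain \<alpha> \<beta> where L: "L = {of_int i *\<^sub>R \<alpha> + of_int j *\<^sub>R \<beta> | i j. True}"
    and ind: "independent {\<alpha>, \<beta>}" "\<alpha> \<noteq> \<beta>" and sp: "span {\<alpha>, \<beta>} = UNIV"
    using lattice_complex1[OF lat] by blast
  have lin: "F (x + y) u = F x u + F y u" "F u (x + y) = F u x + F u y"
    "F (c *\<^sub>R x) u = c * F x u" "F u (c *\<^sub>R x) = c * F u x" for x y u c
    using F(1) by (auto simp: bilinear_ladd bilinear_radd bilinear_lmul bilinear_rmul)
  have anti: "F u v = - F v u" for u v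
  proof -
    have "F (u + v) (u + v) = F u u + F v u + (F u v + F v v)" by (simp only: lin)
    thus ?thesis using F(3) by simp
  qed
  define e where "e = F \<alpha> \<beta>"
  have memL: "of_int i *\<^sub>R \<alpha> + of_int j *\<^sub>R \<beta> \<in> L" for i j using L by blast
  have aL: "\<alpha> \<in> L" "\<beta> \<in> L" "0 \<in> L" using memL[of 1 0] memL[of 0 1] memL[of 0 0] by auto
  have nz: "\<alpha> \<noteq> 0" "\<beta> \<noteq> 0" using ind(1) dependent_zero by blast+
  have e_int: "e \<in> \<int>" using F(5) aL unfolding e_def by blast
  \<comment> \<open>With \<open>e = 0\<close> the form would vanish on the whole real span, against
    positivity at \<alpha>.\<close>
  have e0: "e \<noteq> 0"
  proof
    assume "e = 0"
    have "\<i> *s \<alpha> \<in> span {\<alpha>, \<beta>}" using sp by simp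
    then obtain x y where "\<i> *s \<alpha> = x *\<^sub>R \<alpha> + y *\<^sub>R \<beta>"
      by (auto simp: span_insert span_singleton) (metis add_diff_cancel_left' add_diff_eq diff_add_cancel)
    hence "F (\<i> *s \<alpha>) \<alpha> = 0" using F(3) \<open>e = 0\<close> anti[of \<beta> \<alpha>] by (simp add: lin e_def)
    with F(4) nz show False by (metis less_irrefl)
  qed
  \<comment> \<open>Self-duality: dividing \<beta> by \<open>e\<close> keeps the form integral on
    the lattice. Comparing coefficients then shows that \<open>e\<close> is a unit.\<close>
  have "(1 / e) *\<^sub>R \<beta> \<in> L"
  proof -
    have "F u ((1 / e) *\<^sub>R \<beta>) \<in> \<int>" if "u \<in> L" for u
    proof -
      obtain i j where "u = of_int i *\<^sub>R \<alpha> + of_int j *\<^sub>R \<beta>" using \<open>u \<in> L\<close> L by blast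
      hence "F u ((1 / e) *\<^sub>R \<beta>) = of_int i" using F(3) e0 by (simp add: lin e_def)
      thus ?thesis by simp
    qed
    thus ?thesis using F(5) by blast
  qed
  then obtain i j where "(1 / e) *\<^sub>R \<beta> = of_int i *\<^sub>R \<alpha> + of_int j *\<^sub>R \<beta>" using L by blast
  hence "F \<alpha> ((1 / e) *\<^sub>R \<beta>) = F \<alpha> (of_int i *\<^sub>R \<alpha> + of_int j *\<^sub>R \<beta>)" by simp
  hence "1 = of_int j * e" using F(3) e0 by (simp add: lin flip: e_def)
  moreover obtain k where k: "e = of_int k" using e_int by (auto elim: Ints_cases)
  ultimately have "real_of_int (j * k) = 1" by simp
  hence "j * k = 1" by (simp only: of_int_eq_1_iff)
  hence "k = 1 \<or> k = - 1" by (metis dvd_triv_right zdvd1_eq abs_if minus_equation_iff)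
  hence e1: "e = 1 \<or> e = - 1" using k by auto
  have C: "\<exists>\<tau>. v = \<tau> *s u" if "u \<noteq> 0" for u v :: "complex^1"
  proof
    have "u $ 1 \<noteq> 0" using that by (auto simp: vec_eq_iff)
    thus "v = (v $ 1 / u $ 1) *s u" by (auto simp: vec_eq_iff forall_1)
  qed
  have F0: "F 0 u = 0" "F u 0 = 0" for u using lin(3)[of 0 0 u] lin(4)[of u 0 0] by simp_all
  show thesis
  proof (cases "e = - 1")
    case True
    obtain \<tau> where "\<beta> = \<tau> *s \<alpha>" using C nz by blast
    thus thesis using that[of \<alpha> \<tau>] nz aL F(2) True F0 by (metis e_def)
  next
    case False
    hence "F \<beta> \<alpha> = - 1" using e1 anti[of \<beta> \<alpha>] by (simp add: e_def)
    moreover obtain \<tau> where "\<alpha> = \<tau> *s \<beta>" using C nz by blast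
    ultimately show thesis using that[of \<beta> \<tau>] nz aL F(2) F0 by metis
  qed
qed

section \<open>Theta derivatives at reducible points\<close>

context real_quadratic
begin

text \<open>The normalized periods of both factors, pulled back to the lattice of the surface: (a,
  b) stands for a first period, (c, d) for its multiple by \<tau>.\<close>

lemma reducible_surface_basis:
  assumes z: "z \<in> HH" and red: "reducible (surface D z)"
  obtains a1 b1 c1 d1 a2 b2 c2 d2 \<tau>1 \<tau>2 where
    "a1 \<in> \<O>" "b1 \<in> \<O>d" "c1 \<in> \<O>" "d1 \<in> \<O>d" "a2 \<in> \<O>" "b2 \<in> \<O>d" "c2 \<in> \<O>" "d2 \<in> \<O>d"
    "surface_point D z c1 d1 = \<tau>1 *s surface_point D z a1 b1"
    "surface_point D z c2 d2 = \<tau>2 *s surface_point D z a2 b2"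
    "quad_trace D (a1 * d1 - c1 * b1) = - 1" "quad_trace D (a2 * d2 - c2 * b2) = - 1"
    "quad_trace D (a1 * b2 - a2 * b1) = 0" "quad_trace D (a1 * d2 - c2 * b1) = 0"
    "quad_trace D (a2 * d1 - c1 * b2) = 0"
    "\<And>v. \<exists>x1 x2. v = x1 *s surface_point D z a1 b1 + x2 *s surface_point D z a2 b2"
proof -
  obtain T1 T2 :: "1 torus" where T: "ppav T1" "ppav T2" "polarized_iso (surface D z) (torus_prod T1 T2)"
    using red by (auto simp: reducible_def)
  obtain L1 E1 L2 E2 where LE: "T1 = (L1, E1)" "T2 = (L2, E2)" by (metis surj_pair)
  obtain \<alpha>1 \<tau>1 where 1: "\<alpha>1 \<noteq> 0" "\<alpha>1 \<in> L1" "\<tau>1 *s \<alpha>1 \<in> L1" "E1 \<alpha>1 (\<tau>1 *s \<alpha>1) = - 1" "0 \<in> L1" "E1 0 0 = 0"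
    "E1 \<alpha>1 0 = 0" "E1 0 \<alpha>1 = 0" "E1 (\<tau>1 *s \<alpha>1) 0 = 0" "E1 0 (\<tau>1 *s \<alpha>1) = 0"
    using ppav_complex1[of L1 E1] T(1) LE by blast
  obtain \<alpha>2 \<tau>2 where 2: "\<alpha>2 \<noteq> 0" "\<alpha>2 \<in> L2" "\<tau>2 *s \<alpha>2 \<in> L2" "E2 \<alpha>2 (\<tau>2 *s \<alpha>2) = - 1" "0 \<in> L2" "E2 0 0 = 0"
    "E2 \<alpha>2 0 = 0" "E2 0 \<alpha>2 = 0" "E2 (\<tau>2 *s \<alpha>2) 0 = 0" "E2 0 (\<tau>2 *s \<alpha>2) = 0"
    using ppav_complex1[of L2 E2] T(2) LE by blast
  define L' where "L' = {u :: complex^2. vec (u $ 1) \<in> L1 \<and> vec (u $ 2) \<in> L2}"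
  define E' where "E' = (\<lambda>(u :: complex^2) (v :: complex^2). E1 (vec (u $ 1)) (vec (v $ 1)) + E2 (vec (u $ 2)) (vec (v $ 2)))"
  obtain A where A: "invertible A" "(\<lambda>v. A *v v) ` surface_lattice D z = L'"
    "\<And>u v. u \<in> surface_lattice D z \<Longrightarrow> v \<in> surface_lattice D z \<Longrightarrow> E' (A *v u) (A *v v) = surface_form D z u v"
    using T(3) by (auto simp: polarized_iso_def surface_def LE torus_prod_def L'_def E'_def)
  obtain B where BA: "\<And>v. B *v (A *v v) = v"
    using A(1) by (metis invertible_def matrix_vector_mul_assoc matrix_vector_mul_lid)
  \<comment> \<open>The periods of each factor, placed on its coordinate axis.\<close>
  define p1 q1 p2 q2 :: "complex^2" where
    "p1 = vector [\<alpha>1 $ 1, 0]" "q1 = \<tau>1 *s p1" "p2 = vector [0, \<alpha>2 $ 1]" "q2 = \<tau>2 *s p2"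
  note pq = p1_q1_p2_q2_def
  have v1: "vec (x $ 1) = x" for x :: "complex^1" by (simp add: vec_eq_iff forall_1)
  have v0: "vec 0 = (0 :: complex^1)" by (simp add: vec_eq_iff)
  have vs: "vec (c * (x $ 1)) = c *s x" for x :: "complex^1" and c by (simp add: vec_eq_iff forall_1)
  have nth: "vec (p1 $ 1) = \<alpha>1" "vec (p1 $ 2) = (0 :: complex^1)" "vec (q1 $ 1) = \<tau>1 *s \<alpha>1" "vec (q1 $ 2) = (0 :: complex^1)"
    "vec (p2 $ 2) = \<alpha>2" "vec (p2 $ 1) = (0 :: complex^1)" "vec (q2 $ 2) = \<tau>2 *s \<alpha>2" "vec (q2 $ 1) = (0 :: complex^1)"
    by (simp_all add: pq v1 v0 vs)
  have mem: "p1 \<in> L'" "q1 \<in> L'" "p2 \<in> L'" "q2 \<in> L'"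
    using 1 2 by (simp_all add: L'_def nth)
  have form: "E' p1 q1 = - 1" "E' p2 q2 = - 1" "E' p1 p2 = 0" "E' p1 q2 = 0" "E' p2 q1 = 0"
    using 1 2 by (simp_all add: E'_def nth)
  have pre: "\<exists>a\<in>\<O>. \<exists>b\<in>\<O>d. A *v surface_point D z a b = u" if "u \<in> L'" for u
    using that A(2) by (auto simp: surface_lattice_def)
  obtain a1 b1 where ab1: "a1 \<in> \<O>" "b1 \<in> \<O>d" "A *v surface_point D z a1 b1 = p1" using pre mem(1) by blast
  obtain c1 d1 where cd1: "c1 \<in> \<O>" "d1 \<in> \<O>d" "A *v surface_point D z c1 d1 = q1" using pre mem(2) by blast
  obtain a2 b2 where ab2: "a2 \<in> \<O>" "b2 \<in> \<O>d" "A *v surface_point D z a2 b2 = p2" using pre mem(3) by blast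
  obtain c2 d2 where cd2: "c2 \<in> \<O>" "d2 \<in> \<O>d" "A *v surface_point D z c2 d2 = q2" using pre mem(4) by blast
  have E: "quad_trace D (a * b' - a' * b) = E' (A *v surface_point D z a b) (A *v surface_point D z a' b')"
    if "a \<in> \<O>" "b \<in> \<O>d" "a' \<in> \<O>" "b' \<in> \<O>d" for a b a' b'
    using that surface_form_eq[OF z] A(3) by (simp add: surface_point_in_lattice)
  have B: "surface_point D z a1 b1 = B *v p1" "surface_point D z c1 d1 = B *v q1"
    "surface_point D z a2 b2 = B *v p2" "surface_point D z c2 d2 = B *v q2"
    unfolding ab1(3)[symmetric] ab2(3)[symmetric] cd1(3)[symmetric] cd2(3)[symmetric] by (simp_all only: BA)
  show thesis
  proof (rule that[OF ab1(1,2) cd1(1,2) ab2(1,2) cd2(1,2), of \<tau>1 \<tau>2])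
    show "surface_point D z c1 d1 = \<tau>1 *s surface_point D z a1 b1"
      "surface_point D z c2 d2 = \<tau>2 *s surface_point D z a2 b2"
      unfolding B pq by (simp_all add: vector_scalar_commute)
    show "quad_trace D (a1 * d1 - c1 * b1) = - 1" "quad_trace D (a2 * d2 - c2 * b2) = - 1"
      "quad_trace D (a1 * b2 - a2 * b1) = 0" "quad_trace D (a1 * d2 - c2 * b1) = 0"
      "quad_trace D (a2 * d1 - c1 * b2) = 0"
      using E ab1 cd1 ab2 cd2 form by simp_all
    fix v :: "complex^2"
    have nz: "\<alpha>1 $ 1 \<noteq> 0" "\<alpha>2 $ 1 \<noteq> 0" using 1(1) 2(1) by (auto simp: vec_eq_iff forall_1)
    have "A *v v = ((A *v v) $ 1 / \<alpha>1 $ 1) *s p1 + ((A *v v) $ 2 / \<alpha>2 $ 1) *s p2"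
      using nz by (simp add: vec_eq_iff forall_2 pq)
    hence "B *v (A *v v) = ((A *v v) $ 1 / \<alpha>1 $ 1) *s (B *v p1) + ((A *v v) $ 2 / \<alpha>2 $ 1) *s (B *v p2)"
      by (metis matrix_vector_right_distrib vector_scalar_commute)
    thus "\<exists>x1 x2. v = x1 *s surface_point D z a1 b1 + x2 *s surface_point D z a2 b2"
      unfolding BA B by blast
  qed
qed

lemma rho_eq:
  assumes "m \<in> {0, 1/2} \<times> {0, 1/2}"
  shows "rho D m x = (of_int (fst x) + fst m) + (of_int (snd x) + snd m) * gamma0 D"
    "cj (rho D m x) = (of_int (fst x) + fst m) + (of_int (snd x) + snd m) * ((of_int D - w) / 2)"
proof -
  have r: "fst m \<in> \<rat>" "snd m \<in> \<rat>" using assms by auto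
  have "rho D m x \<in> K \<and> cj (rho D m x) = (of_int (fst x) + fst m) + (of_int (snd x) + snd m) * ((of_int D - w) / 2)"
    using r gamma0_in_K unfolding rho_def by (simp add: conj_add conj_mult mult_in_K rat_in_K conj_rat conj_gamma0 add_in_K)
  thus "cj (rho D m x) = (of_int (fst x) + fst m) + (of_int (snd x) + snd m) * ((of_int D - w) / 2)" ..
qed (rule rho_def)

text \<open>At M = 2 m the exponent is 4 m \<bullet> m', which is odd. Writing the entries of the
  characteristic as halves of integers removes the floor and makes the sign a character.\<close>

lemma theta_sign:
  assumes "(m, m') \<in> odd_characteristics"
  defines "\<epsilon> \<equiv> \<lambda>x :: int \<times> int. (- 1 :: complex) powi \<lfloor>2 * ((of_int (fst x), of_int (snd x)) \<bullet> m')\<rfloor>"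
  obtains M where "2 * fst m = of_int (fst M)" "2 * snd m = of_int (snd M)" "\<epsilon> M = - 1"
    "\<And>x. \<epsilon> x = 1 \<or> \<epsilon> x = - 1" "\<And>x y. \<epsilon> (x + y) = \<epsilon> x * \<epsilon> y"
proof -
  have "\<exists>i j. fst n = of_int i / 2 \<and> snd n = of_int j / 2" if "n \<in> {0, 1/2} \<times> {0, 1/2}" for n :: half_vec
  proof -
    have "\<exists>i. t = of_int i / 2" if "t \<in> {0, 1/2}" for t :: real
      using that by (auto intro: exI[of _ 0] exI[of _ 1])
    thus ?thesis using that by (auto simp: mem_Times_iff)
  qed
  moreover have "m \<in> {0, 1/2} \<times> {0, 1/2}" "m' \<in> {0, 1/2} \<times> {0, 1/2}"
    using assms(1) by (auto simp: odd_characteristics_def characteristics_def)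
  ultimately obtain i j i' j' where m: "fst m = of_int i / 2" "snd m = of_int j / 2"
    "fst m' = of_int i' / 2" "snd m' = of_int j' / 2" by meson
  have e: "\<epsilon> x = (- 1) powi (fst x * i' + snd x * j')" for x
  proof -
    have "2 * ((of_int (fst x), of_int (snd x)) \<bullet> m') = (of_int (fst x * i' + snd x * j') :: real)"
      by (simp add: inner_prod_def m)
    thus ?thesis unfolding \<epsilon>_def by (simp only: floor_of_int)
  qed
  obtain k where k: "odd k" "4 * (m \<bullet> m') = of_int k"
    using assms(1) by (auto simp: odd_characteristics_def)
  have "4 * (m \<bullet> m') = of_int (i * i' + j * j')" by (simp add: inner_prod_def m)
  hence k': "k = i * i' + j * j'" using k(2) by (metis of_int_eq_iff)
  show thesis
  proof
    show "2 * fst m = of_int (fst (i, j))" "2 * snd m = of_int (snd (i, j))" by (simp_all add: m)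
    show "\<epsilon> (i, j) = - 1" using k(1) by (simp add: e k' power_int_minus_left)
    show "\<epsilon> x = 1 \<or> \<epsilon> x = - 1" for x by (simp add: e power_int_minus_left)
    show "\<epsilon> (x + y) = \<epsilon> x * \<epsilon> y" for x y
      by (auto simp: e power_int_minus_left)
  qed
qed

lemma D2_theta_nonzero:
  assumes z: "z \<in> HH" and odd: "(m, m') \<in> odd_characteristics" and red: "reducible (surface D z)"
  shows "D2_theta D m m' z \<noteq> 0"
proof -
  define \<epsilon> where "\<epsilon> = (\<lambda>x :: int \<times> int. (- 1 :: complex) powi \<lfloor>2 * ((of_int (fst x), of_int (snd x)) \<bullet> m')\<rfloor>)"
  obtain M where M: "2 * fst m = of_int (fst M)" "2 * snd m = of_int (snd M)" "\<epsilon> M = - 1"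
    "\<And>x. \<epsilon> x = 1 \<or> \<epsilon> x = - 1" "\<And>x y. \<epsilon> (x + y) = \<epsilon> x * \<epsilon> y"
    using theta_sign[OF odd] unfolding \<epsilon>_def by blast
  interpret quad_theta "gamma0 D" "(of_int D - w) / 2" "fst m" "snd m" M \<epsilon> "fst z" "snd z"
    using z M D_pos by unfold_locales (auto simp: HH_def gamma0_def)
  obtain a1 b1 c1 d1 a2 b2 c2 d2 \<tau>1 \<tau>2 where mem:
    "a1 \<in> \<O>" "b1 \<in> \<O>d" "c1 \<in> \<O>" "d1 \<in> \<O>d" "a2 \<in> \<O>" "b2 \<in> \<O>d" "c2 \<in> \<O>" "d2 \<in> \<O>d"
    and tau: "surface_point D z c1 d1 = \<tau>1 *s surface_point D z a1 b1"
      "surface_point D z c2 d2 = \<tau>2 *s surface_point D z a2 b2"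
    and form: "quad_trace D (a1 * d1 - c1 * b1) = - 1" "quad_trace D (a2 * d2 - c2 * b2) = - 1"
      "quad_trace D (a1 * b2 - a2 * b1) = 0" "quad_trace D (a1 * d2 - c2 * b1) = 0"
      "quad_trace D (a2 * d1 - c1 * b2) = 0"
    and gen: "\<And>v. \<exists>x1 x2. v = x1 *s surface_point D z a1 b1 + x2 *s surface_point D z a2 b2"
    using reducible_surface_basis[OF z red] by metis
  define p1 p2 where "p1 = surface_point D z a1 b1" "p2 = surface_point D z a2 b2"
  note p_def = p1_p2_def
  \<comment> \<open>The linear form in the exponent of the automorphy factor for a lattice vector
    with first coefficient \<open>a\<close>.\<close>
  define l where "l = (\<lambda>a (v :: complex^2). of_real a * v $ 1 + of_real (cj a) * v $ 2)"
  define f where "f = (\<lambda>v :: complex^2. \<Theta> (v $ 1) (v $ 2))"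
  have trans: "\<exists>k. k \<noteq> 0 \<and> (\<forall>v. f (v + surface_point D z a b) = k * e2pi (- l a v) * f v)"
    if a: "a \<in> \<O>" and b: "b \<in> \<O>d" for a b
  proof -
    obtain i j where ij: "a = of_int i + of_int j * gamma0 D" "cj a = of_int i + of_int j * ((of_int D - w) / 2)"
      using ring_of_intsE a by blast
    obtain k where "k \<noteq> 0" "\<And>v1 v2. \<Theta> (v1 + (of_real a * fst z + of_real b)) (v2 + (of_real (cj a) * snd z + of_real (cj b)))
      = k * e2pi (- (of_real a * v1 + of_real (cj a) * v2)) * \<Theta> v1 v2"
      by (rule Theta_translate[of a "(i, j)" "cj a" b "cj b"]) (use ij Od_trace[OF b] in auto)
    thus ?thesis unfolding f_def l_def by auto
  qed
  obtain k1 where k1: "k1 \<noteq> 0" "\<And>v. f (v + p1) = k1 * e2pi (- l a1 v) * f v"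
    using trans[of a1 b1] mem unfolding p_def by blast
  obtain k2 where k2: "k2 \<noteq> 0" "\<And>v. f (v + p2) = k2 * e2pi (- l a2 v) * f v"
    using trans[of a2 b2] mem unfolding p_def by blast
  obtain k3 where k3: "k3 \<noteq> 0" "\<And>v. f (v + \<tau>1 *s p1) = k3 * e2pi (- l c1 v) * f v"
    using trans[of c1 d1] mem unfolding tau p_def by blast
  obtain k4 where k4: "k4 \<noteq> 0" "\<And>v. f (v + \<tau>2 *s p2) = k4 * e2pi (- l c2 v) * f v"
    using trans[of c2 d2] mem unfolding tau p_def by blast
  have l_lin: "l a (x *s u + y *s v) = x * l a u + y * l a v" "l a (x *s u) = x * l a u" for a x y u v
    by (simp_all add: l_def algebra_simps)
  have pairing: "l a (surface_point D z a' b') - l a' (surface_point D z a b) = of_real (quad_trace D (a * b' - a' * b))"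
    if "a \<in> \<O>" "b \<in> \<O>d" "a' \<in> \<O>" "b' \<in> \<O>d" for a b a' b'
  proof -
    have "a \<in> K" "b \<in> K" "a' \<in> K" "b' \<in> K" using that O_in_K Od_in_K by auto
    hence "quad_trace D (a * b' - a' * b) = a * b' - a' * b + (cj a * cj b' - cj a' * cj b)"
      by (simp add: quad_trace_def conj_diff conj_mult mult_in_K)
    thus ?thesis
      by (simp only: l_def surface_point_nth of_real_add of_real_diff of_real_mult) (simp add: algebra_simps)
  qed
  \<comment> \<open>Orthogonality equates the mixed values; the value -1 on each curve becomes the
    summand 1 that makes the degree 1.\<close>
  have l_eqs: "l a2 p1 = l a1 p2" "l c1 p1 = \<tau>1 * l a1 p1 + 1" "l c1 p2 = \<tau>1 * l a1 p2"
    "l c2 p2 = \<tau>2 * l a2 p2 + 1" "l c2 p1 = \<tau>2 * l a1 p2"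
    using pairing[of a1 b1 a2 b2] pairing[of a1 b1 c1 d1] pairing[of a2 b2 c1 d1]
      pairing[of a2 b2 c2 d2] pairing[of a1 b1 c2 d2] mem
    unfolding form tau p_def[symmetric] l_lin by (simp_all add: algebra_simps add_eq_0_iff)
  define H where "H = (\<lambda>s1 s2. f (s1 *s p1 + s2 *s p2))"
  \<comment> \<open>The coordinates, along the two curves, of the direction (0, 1) of the theta
    derivative.\<close>
  obtain x1 x2 where x: "vector [0, 1] = x1 *s p1 + x2 *s p2" using gen unfolding p_def by blast
  have x': "x1 * p1 $ 1 + x2 * p2 $ 1 = 0" "x1 * p1 $ 2 + x2 * p2 $ 2 = 1"
    using arg_cong[OF x, of "\<lambda>v. v $ 1"] arg_cong[OF x, of "\<lambda>v. v $ 2"] by simp_all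
  \<comment> \<open>A period with first coordinate 0 has a = b = 0 and is the zero vector. If
    \<open>x1\<close> or \<open>x2\<close> were 0, the other period would be a nonzero multiple of
    (0, 1), which this forbids.\<close>
  have p_nz: "p1 $ 1 = 0 \<Longrightarrow> p1 $ 2 = 0" "p2 $ 1 = 0 \<Longrightarrow> p2 $ 2 = 0"
    using z real_lin_eq_iff[of "fst z" a1 b1 0 0] real_lin_eq_iff[of "fst z" a2 b2 0 0]
    by (auto simp: p_def HH_def)
  have x1: "x1 \<noteq> 0" and x2: "x2 \<noteq> 0" using x' p_nz by auto
  obtain v1 v2 where "\<Theta> v1 v2 \<noteq> 0" using Theta_nonzero by blast
  hence "f (vector [v1, v2]) \<noteq> 0" by (simp add: f_def)
  moreover obtain s1' s2' where "vector [v1, v2] = s1' *s p1 + s2' *s p2" using gen unfolding p_def by blast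
  ultimately have nz: "H s1' s2' \<noteq> 0" by (simp add: H_def)
  define S where "S = (\<Sum>\<^sub>\<infinity>x. \<epsilon> x * of_real (r' x) *
       e2pi (1/2 * of_real ((r x)\<^sup>2) * fst z + 1/2 * of_real ((r' x)\<^sup>2) * snd z))"
  have "2 * of_real pi * \<i> * S \<noteq> 0"
  proof (rule odd_degree_1_theta_derivative_nonzero)
    show "(\<lambda>s1. H s1 s2) holomorphic_on UNIV" for s2
      using holomorphic_Theta_line[of "p1 $ 1" "s2 * p2 $ 1" "p1 $ 2" "s2 * p2 $ 2"] by (simp add: H_def f_def)
    show "(\<lambda>s2. H s1 s2) holomorphic_on UNIV" for s1
      using holomorphic_Theta_line[of "p2 $ 1" "s1 * p1 $ 1" "p2 $ 2" "s1 * p1 $ 2"] by (simp add: H_def f_def add.commute)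
    show "H (- s1) (- s2) = - H s1 s2" for s1 s2
    proof -
      have "- s1 *s p1 + - s2 *s p2 = - (s1 *s p1 + s2 *s p2)" by (simp add: vec_eq_iff)
      moreover have "f (- v) = - f v" for v using Theta_odd by (simp add: f_def)
      ultimately show ?thesis by (simp only: H_def)
    qed
    show "H s1' s2' \<noteq> 0" by (rule nz)
    show "k1 \<noteq> 0" "k2 \<noteq> 0" "k3 \<noteq> 0" "k4 \<noteq> 0" "x1 \<noteq> 0" "x2 \<noteq> 0" by fact+
    have sh: "(s1 + t) *s p1 + s2 *s p2 = (s1 *s p1 + s2 *s p2) + t *s p1"
      "s1 *s p1 + (s2 + t) *s p2 = (s1 *s p1 + s2 *s p2) + t *s p2" for s1 s2 t
      by (simp_all add: vec_eq_iff algebra_simps)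
    show "H (s1 + 1) s2 = k1 * e2pi (- (l a1 p1 * s1 + l a1 p2 * s2)) * H s1 s2" for s1 s2
      unfolding H_def sh vector_smult_lid k1(2) l_lin by (simp add: mult.commute)
    show "H s1 (s2 + 1) = k2 * e2pi (- (l a1 p2 * s1 + l a2 p2 * s2)) * H s1 s2" for s1 s2
      unfolding H_def sh vector_smult_lid k2(2) l_lin l_eqs by (simp add: mult.commute)
    show "H (s1 + \<tau>1) s2 = k3 * e2pi (- ((\<tau>1 * l a1 p1 + 1) * s1 + \<tau>1 * l a1 p2 * s2)) * H s1 s2" for s1 s2
      unfolding H_def sh vector_smult_lid k3(2) l_lin l_eqs by (simp add: mult.commute)
    show "H s1 (s2 + \<tau>2) = k4 * e2pi (- (\<tau>2 * l a1 p2 * s1 + (\<tau>2 * l a2 p2 + 1) * s2)) * H s1 s2" for s1 s2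
      unfolding H_def sh vector_smult_lid k4(2) l_lin l_eqs by (simp add: mult.commute)
    have "H (x1 * t) (x2 * t) = \<Theta> 0 t" for t
    proof -
      have "(x1 * t) *s p1 + (x2 * t) *s p2 = t *s vector [0, 1]"
        by (simp add: x vec_eq_iff algebra_simps)
      thus ?thesis unfolding H_def by (simp only:) (simp add: f_def)
    qed
    thus "((\<lambda>t. H (x1 * t) (x2 * t)) has_field_derivative 2 * of_real pi * \<i> * S) (at 0)"
      using has_field_derivative_Theta_2 unfolding S_def by simp
  qed
  hence "S \<noteq> 0" by simp
  moreover have "D2_theta D m m' z = \<i> powi \<lfloor>4 * (m \<bullet> m')\<rfloor> * S"
  proof -
    have "m \<in> {0, 1/2} \<times> {0, 1/2}"
      using odd by (auto simp: odd_characteristics_def characteristics_def)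
    from rho_eq[OF this] have "rho D m x = r x" "cj (rho D m x) = r' x" for x
      by (simp_all add: r_def r'_def)
    thus ?thesis by (simp add: D2_theta_def S_def \<epsilon>_def)
  qed
  ultimately show ?thesis by simp
qed

end

theorem theorem12p2:
  fixes D :: int
  assumes "D > 0" and "fundamental_discriminant D"
  shows "W_locus D \<inter> P_locus D = {}"
proof -
  interpret real_quadratic D using assms by unfold_locales
  have False if W: "c \<in> W_locus D" and P: "c \<in> P_locus D" for c
  proof -
    obtain z where z: "z \<in> c" "D_theta D z = 0" and X: "c \<in> X_surface D"
      using W by (auto simp: W_locus_def)
    obtain z' where "z' \<in> c" "reducible (surface D z')" using P by (auto simp: P_locus_def)
    \<comment> \<open>Moves reducibility from \<open>z'\<close> to the zero \<open>z\<close> of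
      \<open>D_theta\<close>.\<close>
    with reducible_orbit[OF X z(1)] have "z \<in> HH" "reducible (surface D z)" by auto
    moreover have "finite odd_characteristics"
      by (rule finite_subset[of _ characteristics]) (auto simp: odd_characteristics_def characteristics_def)
    with z(2) obtain m m' where "(m, m') \<in> odd_characteristics" "D2_theta D m m' z = 0"
      by (auto simp: D_theta_def prod_zero_iff)
    ultimately show False using D2_theta_nonzero by blast
  qed
  thus ?thesis by blast
qed

end
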